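(* Let $1\le k<n$, let $f$ be a real-valued differentiable function on a neighborhood $\mathrm{St}_\delta(k,n)$ of $\mathrm{St}(k,n)$, and suppose that the NEPv Ansatz holds for $f$ with a continuous symmetric matrix-valued function $H(P)\in\mathbb{R}^{n\times n}$ and a subset $\mathbb{P}\subseteq\mathrm{St}(k,n)$. Let $\{P^{(i)}\}_{i=0}^\infty$ be generated by Algorithm NEPvSCF (described in the context) from some $P^{(0)}\in\mathbb{P}$, and let $P_*$ be an accumulation point of the sequence $\{P^{(i)}\}_{i=0}^\infty$. (a) $\mathcal{R}(P_* )$ is an accumulation point of the sequence $\{\mathcal{R}(P^{(i)})\}_{i=0}^\infty$. (b) Suppose that $\mathcal{R}(P_* )$ is an isolated accumulation point of $\{\mathcal{R}(P^{(i)})\}_{i=0}^\infty$. If $$\lambda_k(H(P_*Q))-\lambda_{k+1}(H(P_*Q))>0\quad\text{for any }Q\in\mathrm{St}(k,k),$$ then the entire sequence $\{\mathcal{R}(P^{(i)})\}_{i=0}^\infty$ converges to $\mathcal{R}(P_* )$. (c) Suppose that $P_*$ is an isolated accumulation point of $\{P^{(i)}\}_{i=0}^\infty$. If $\lambda_k(H(P_* ))-\lambda_{k+1}(H(P_* ))>0$ and if $f(P_* )>f(P)$ for any $P\in\mathrm{St}(k,n)$ with $P\ne P_*$ and $\mathcal{R}(P)=\mathcal{R}(P_* )$ (i.e. $f$ has a unique maximizer, namely $P_*$, in the orbit $\{P_*Q:Q\in\mathrm{St}(k,k)\}$), then the entire sequence $\{P^{(i)}\}_{i=0}^\infty$ converges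 to $P_*$. (d) Suppose that $f(\cdot)$ and $H(\cdot)$ are right-unitarily invariant. For $i\ge0$ let $V_i\in\mathrm{St}(k,k)$ be an orthonormal polar factor of $[P^{(i)}]^{\mathrm T}P_*$. If $P_*$ is an isolated accumulation point of $\{P^{(i)}V_i\}_{i=0}^\infty$ and if $\lambda_k(H(P_* ))-\lambda_{k+1}(H(P_* ))>0$, then the entire sequence $\{P^{(i)}V_i\}_{i=0}^\infty$ converges to $P_*$.
   Context: $\mathrm{St}(k,n)=\{P\in\mathbb{R}^{n\times k}: P^{\mathrm T}P=I_k\}$; $\mathrm{St}_\delta(k,n)=\{P\in\mathbb{R}^{n\times k}:\|P^{\mathrm T}P-I_k\|<\delta\}$ for some $\delta>0$ and some matrix norm. Eigenvalues of a symmetric $A\in\mathbb{R}^{n\times n}$ are ordered $\lambda_1(A)\ge\cdots\ge\lambda_n(A)$, counted with multiplicity. $\mathcal{R}(B)$ is the column space of $B$. Convergence and accumulation points of $k$-dimensional subspaces of $\mathbb{R}^n$ are with respect to the metric $\mathrm{dist}_2(\mathcal{X},\mathcal{Y})=\|\sin\Theta(\mathcal{X},\mathcal{Y})\|_2=\max_i\sin\theta_i$, where for $\mathcal{X}=\mathcal{R}(X)$, $\mathcal{Y}=\mathcal{R}(Y)$, $X,Y\in\mathrm{St}(k,n)$, $\theta_i=\arccos\sigma_i(X^{\mathrm T}Y)$. A function $F$ of $P$ is right-unitarily invariant if $F(PQ)=F(P)$ for all $P$ in its domain and all $Q\in\mathrm{St}(k,k)$. An orthonormal polar factor of $B\in\mathbb{R}^{k\times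 k}$ is a $V\in\mathrm{St}(k,k)$ with $B=V\Omega$ for some symmetric positive semidefinite $\Omega$. NEPv Ansatz (for $f$ with $H$ and $\mathbb{P}$): there is a constant $\omega>0$ (independent of $P$ and $\widehat P$) such that whenever $P\in\mathbb{P}$, $\widehat P\in\mathrm{St}(k,n)$ and $\eta\in\mathbb{R}$ satisfy $\mathrm{tr}(\widehat P^{\mathrm T}H(P)\widehat P)\ge\mathrm{tr}(P^{\mathrm T}H(P)P)+\eta$, there exists $Q\in\mathrm{St}(k,k)$ such that $\widetilde P=\widehat PQ\in\mathbb{P}$ and $f(\widetilde P)\ge f(P)+\omega\eta$. Algorithm NEPvSCF: given $P^{(0)}\in\mathbb{P}$, for $i=0,1,2,\dots$ (run indefinitely): let $\widehat P^{(i)}\in\mathrm{St}(k,n)$ be an orthonormal basis matrix of an eigenspace (invariant subspace) of $H(P^{(i)})$ associated with its $k$ largest eigenvalues; take $Q_i\in\mathrm{St}(k,k)$ as supplied by the NEPv Ansatz for $P=P^{(i)}$, $\widehat P=\widehat P^{(i)}$ and $\eta=\eta_i:=\mathrm{tr}([\widehat P^{(i)}]^{\mathrm T}H(P^{(i)})\widehat P^{(i)})-\mathrm{tr}([P^{(i)}]^{\mathrm T}H(P^{(i)})P^{(i)})$, i.e. such that $P^{(i+1)}:=\widehat P^{(i)}Q_i\in\mathbb{P}$ and $f(P^{(i+1)})\ge f(P^{(i)})+\omega\eta_i$. *)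

theory Defs
  imports "HOL-Analysis.Analysis" "HOL-Computational_Algebra.Polynomial"
begin

text \<open>
  An \<open>n \<times> k\<close> real matrix has type \<open>real^'k^'n\<close>, with \<open>n = CARD('n)\<close> and \<open>k = CARD('k)\<close>.
\<close>

section \<open>Stiefel manifolds\<close>

definition stiefel :: "(real^'k^'n) set" where
  "stiefel = {P. transpose P ** P = mat 1}"

text \<open>Submultiplicativity is not required, so every norm on the matrix space is admitted.\<close>

definition matrix_norm :: "(real^'k^'k \<Rightarrow> real) \<Rightarrow> bool" where
  "matrix_norm N \<longleftrightarrow>
     (\<forall>A. N A = 0 \<longleftrightarrow> A = 0) \<and>
     (\<forall>c A. N (c *\<^sub>R A) = \<bar>c\<bar> * N A) \<and>
     (\<forall>A B. N (A + B) \<le> N A + N B)"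

definition stiefel_nbhd :: "(real^'k^'k \<Rightarrow> real) \<Rightarrow> real \<Rightarrow> (real^'k^'n) set" where
  "stiefel_nbhd N \<delta> = {P. N (transpose P ** P - mat 1) < \<delta>}"

definition colspace :: "real^'k^'n \<Rightarrow> (real^'n) set" where
  "colspace B = span (columns B)"

text \<open>
  The guard \<open>P ** Q \<in> D\<close> keeps the condition from constraining values of \<open>F\<close> outside its
  domain \<open>D\<close>. It is automatic for \<open>D = stiefel\<close>, but not for \<^const>\<open>stiefel_nbhd\<close> with a norm
  that is not invariant under orthogonal similarity.
\<close>

definition right_unitarily_invariant_on :: "(real^'k^'n) set \<Rightarrow> (real^'k^'n \<Rightarrow> 'b) \<Rightarrow> bool" where
  "right_unitarily_invariant_on D F \<longleftrightarrow>
     (\<forall>P\<in>D. \<forall>Q::real^'k^'k. Q \<in> stiefel \<and> P ** Q \<in> D \<longrightarrow> F (P ** Q) = F P)"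

definition orthonormal_polar_factor :: "real^'k^'k \<Rightarrow> real^'k^'k \<Rightarrow> bool" where
  "orthonormal_polar_factor B V \<longleftrightarrow> V \<in> stiefel \<and>
     (\<exists>\<Omega>. transpose \<Omega> = \<Omega> \<and> (\<forall>x. 0 \<le> x \<bullet> (\<Omega> *v x)) \<and> B = V ** \<Omega>)"

section \<open>Eigenvalues and singular values\<close>

definition charpoly :: "real^'m^'m \<Rightarrow> real poly" where
  "charpoly A = det (mat [:0, 1:] - (\<chi> i j. [:A $ i $ j:]))"

text \<open>
  The \<open>j\<close>-th largest eigenvalue, \<open>1 \<le> j \<le> CARD('m)\<close>, counted with (algebraic) multiplicity.
  It is meaningful for matrices all of whose eigenvalues are real, in particular symmetric ones.
\<close>

definition eigval :: "nat \<Rightarrow> real^'m^'m \<Rightarrow> real" where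
  "eigval j A = rev (sorted_list_of_multiset (proots (charpoly A))) ! (j - 1)"

definition singval :: "nat \<Rightarrow> real^'k^'m \<Rightarrow> real" where
  "singval j B = sqrt (eigval j (transpose B ** B))"

text \<open>
  \<open>X\<close> is an orthonormal basis matrix of an invariant subspace of \<open>A\<close>, and the restriction of
  \<open>A\<close> to it, represented by \<open>\<Lambda>\<close> in this basis, has the \<open>k\<close> largest eigenvalues of \<open>A\<close> as its
  eigenvalues.
\<close>

definition top_eigenspace_basis :: "real^'n^'n \<Rightarrow> real^'k^'n \<Rightarrow> bool" where
  "top_eigenspace_basis A X \<longleftrightarrow> X \<in> stiefel \<and>
     (\<exists>\<Lambda>::real^'k^'k. A ** X = X ** \<Lambda> \<and> (\<forall>j\<in>{1..CARD('k)}. eigval j \<Lambda> = eigval j A))"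

section \<open>Subspaces of dimension \<open>k\<close>\<close>

definition grassmannian :: "'k itself \<Rightarrow> (real^'n) set set" where
  "grassmannian _ = {S. subspace S \<and> dim S = CARD('k)}"

definition canonical_angle :: "nat \<Rightarrow> real^'k^'n \<Rightarrow> real^'k^'n \<Rightarrow> real" where
  "canonical_angle j X Y = arccos (singval j (transpose X ** Y))"

text \<open>
  The value is independent of the chosen orthonormal bases. Outside the Grassmannian it is set
  to \<open>0\<close>, because \<^locale>\<open>Metric_space\<close> requires nonnegativity and symmetry on the whole type.
\<close>

definition dist2 :: "'k::finite itself \<Rightarrow> (real^'n) set \<Rightarrow> (real^'n) set \<Rightarrow> real" where
  "dist2 k S T =
     (if S \<in> grassmannian k \<and> T \<in> grassmannian k
      then THE d. \<exists>X Y :: real^'k^'n. X \<in> stiefel \<and> Y \<in> stiefel \<and> colspace X = S \<and> colspace Y = T \<and>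
             d = Max ((\<lambda>j. sin (canonical_angle j X Y)) ` {1..CARD('k)})
      else 0)"

definition grassmann_topology :: "'k::finite itself \<Rightarrow> (real^'n) set topology" where
  "grassmann_topology k = Metric_space.mtopology (grassmannian k) (dist2 k)"

section \<open>Accumulation points of sequences\<close>

definition accumulation_point :: "'a topology \<Rightarrow> (nat \<Rightarrow> 'a) \<Rightarrow> 'a \<Rightarrow> bool" where
  "accumulation_point T x l \<longleftrightarrow> (\<exists>r. strict_mono r \<and> limitin T (x \<circ> r) l sequentially)"

definition isolated_accumulation_point :: "'a topology \<Rightarrow> (nat \<Rightarrow> 'a) \<Rightarrow> 'a \<Rightarrow> bool" where
  "isolated_accumulation_point T x l \<longleftrightarrow> accumulation_point T x l \<and>
     (\<exists>U. openin T U \<and> l \<in> U \<and> (\<forall>l'\<in>U. accumulation_point T x l' \<longrightarrow> l' = l))"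

section \<open>The NEPv Ansatz and the SCF iteration\<close>

definition trace_form :: "real^'n^'n \<Rightarrow> real^'k^'n \<Rightarrow> real" where
  "trace_form A X = trace (transpose X ** A ** X)"

definition NEPv_ansatz ::
    "(real^'k^'n \<Rightarrow> real) \<Rightarrow> (real^'k^'n \<Rightarrow> real^'n^'n) \<Rightarrow> (real^'k^'n) set \<Rightarrow> real \<Rightarrow> bool" where
  "NEPv_ansatz f H PP \<omega> \<longleftrightarrow> \<omega> > 0 \<and>
     (\<forall>P\<in>PP. \<forall>Phat\<in>stiefel. \<forall>\<eta>.
        trace_form (H P) Phat \<ge> trace_form (H P) P + \<eta> \<longrightarrow>
        (\<exists>Q::real^'k^'k. Q \<in> stiefel \<and> Phat ** Q \<in> PP \<and> f (Phat ** Q) \<ge> f P + \<omega> * \<eta>))"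

definition NEPv_SCF ::
    "(real^'k^'n \<Rightarrow> real) \<Rightarrow> (real^'k^'n \<Rightarrow> real^'n^'n) \<Rightarrow> (real^'k^'n) set \<Rightarrow> real
      \<Rightarrow> (nat \<Rightarrow> real^'k^'n) \<Rightarrow> bool" where
  "NEPv_SCF f H PP \<omega> P \<longleftrightarrow> P 0 \<in> PP \<and>
     (\<forall>i. \<exists>Phat. \<exists>Q::real^'k^'k.
        top_eigenspace_basis (H (P i)) Phat \<and> Q \<in> stiefel \<and>
        P (Suc i) = Phat ** Q \<and> P (Suc i) \<in> PP \<and>
        f (P (Suc i)) \<ge> f (P i) + \<omega> * (trace_form (H (P i)) Phat - trace_form (H (P i)) (P i)))"

end

theory Submission
  imports Defs
begin

text \<open>
  Each iterate \<open>P (Suc i)\<close> maximises the trace form of \<open>H (P i)\<close> (Ky Fan), so \<open>f \<circ> P\<close> increases by at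
  least \<open>\<omega>\<close> times the gain in the trace form. As \<open>f\<close> is bounded on the compact Stiefel manifold, the
  gains tend to \<open>0\<close>. Hence, if a subsequence of \<open>P\<close> converges to \<open>Z\<close>, both \<open>Z\<close> and every
  accumulation point \<open>W\<close> of the successors maximise the trace form of \<open>H Z\<close>. The spectral gap makes
  the maximising subspace unique, so \<open>W\<close> and \<open>Z\<close> have the same column space. An isolated
  accumulation point with this successor property is the limit of the whole sequence. The unique
  maximiser in (c) and the polar factors in (d) remove the remaining freedom \<open>W = Z ** Q\<close>.
\<close>


section \<open>Spectral theorem and eigenvalues\<close>

text \<open>Two definitions shape the development. \<open>eigval\<close> reads a sorted list of
  roots of a characteristic polynomial, so the spectral theorem must be tied to that list before any
  variational argument about the largest eigenvalues is possible. \<open>dist2\<close> comes from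
  canonical angles, which reveal neither symmetry nor the triangle inequality; it is therefore
  identified with the operator norm of the part of one basis matrix orthogonal to the other column
  space. In (b), convergence of column spaces fixes the matrices only up to a right orthogonal
  factor: a convergent subsequence of \<open>P\<close> has limit \<open>Ps ** Q\<close> with unknown
  \<open>Q\<close>, which is why the gap is assumed at every such point. In (c), \<open>f\<close>
  takes the same value at \<open>W\<close> and at \<open>Ps\<close>, because \<open>f (P i)\<close>
  converges. In (d), the limit of \<open>transpose (V i) ** (transpose (P i) ** Ps)\<close> along
  the successors is both orthogonal and symmetric positive semidefinite, hence the identity. The
  convergence criterion is phrased for regular spaces so that it covers matrices and subspaces
  alike.\<close>

lemma inner_transpose_mult: "(transpose A *v x) \<bullet> y = x \<bullet> (A *v y)" for A :: "real^'k^'n"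
  by (simp add: dot_lmul_matrix)

text \<open>A maximiser \<open>v\<close> of the quadratic form on the unit sphere of
  \<open>W\<close> is an eigenvector: the residual \<open>A *v v - M *\<^sub>R v\<close> stays in
  \<open>W\<close> by invariance, so moving \<open>v\<close> along it is admissible and would
  increase the Rayleigh quotient if the residual were nonzero.\<close>

lemma symmetric_eigenvector_in_subspace:
  fixes A :: "real^'n^'n"
  assumes sym: "transpose A = A" and W: "subspace W" "\<And>x. x \<in> W \<Longrightarrow> A *v x \<in> W" "W \<noteq> {0}"
  obtains v where "v \<in> W" "norm v = 1" "A *v v = (v \<bullet> (A *v v)) *\<^sub>R v"
proof -
  have symA: "x \<bullet> (A *v y) = (A *v x) \<bullet> y" for x y
    using inner_transpose_mult[of A x y] sym by simp
  obtain w where w: "w \<in> W" "w \<noteq> 0"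
    using W(1,3) subspace_0 by blast
  then have "w /\<^sub>R norm w \<in> W \<inter> sphere 0 1"
    using W(1) by (auto intro: subspace_scale)
  moreover have "compact (W \<inter> sphere 0 1)"
    using closed_subspace[OF W(1)] by (simp add: closed_Int_compact)
  moreover have "continuous_on (W \<inter> sphere 0 1) (\<lambda>x. x \<bullet> (A *v x))"
    by (intro continuous_intros)
  ultimately obtain v where v: "v \<in> W \<inter> sphere 0 1"
    and vmax: "\<And>x. x \<in> W \<inter> sphere 0 1 \<Longrightarrow> x \<bullet> (A *v x) \<le> v \<bullet> (A *v v)"
    using continuous_attains_sup[of "W \<inter> sphere 0 1" "\<lambda>x. x \<bullet> (A *v x)"] by blast
  define M where "M = v \<bullet> (A *v v)"
  have nv: "v \<bullet> v = 1" using v by (simp add: norm_eq_1)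
  have le: "x \<bullet> (A *v x) \<le> M * (x \<bullet> x)" if "x \<in> W" for x
  proof (cases "x = 0")
    case False
    have "x /\<^sub>R norm x \<in> W \<inter> sphere 0 1"
      using W(1) that False by (auto intro: subspace_scale)
    from vmax[OF this] have "(x \<bullet> (A *v x)) / (norm x)^2 \<le> M"
      by (simp add: M_def matrix_vector_mult_scaleR power2_eq_square divide_inverse mult_ac)
    then show ?thesis using False by (simp add: divide_simps power2_norm_eq_inner)
  qed simp
  define w where "w = A *v v - M *\<^sub>R v"
  have wW: "w \<in> W"
    unfolding w_def using W v by (auto intro: subspace_diff subspace_scale)
  have vw: "v \<bullet> w = 0" by (simp add: w_def inner_diff_right M_def nv)
  have ww: "w \<bullet> (A *v v) = w \<bullet> w"
    using vw by (simp add: w_def inner_diff_right inner_commute)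
  \<comment> \<open>This is \<open>le\<close> at \<open>v + t *\<^sub>R w\<close>. As
    \<open>w\<close> is orthogonal to \<open>v\<close>, the left side is the first-order gain and
    the right side collects the second-order terms.\<close>
  have quad: "2 * t * (w \<bullet> w) \<le> t^2 * (M * (w \<bullet> w) - w \<bullet> (A *v w))" for t
  proof -
    have "v + t *\<^sub>R w \<in> W" using W v wW by (auto intro: subspace_add subspace_scale)
    from le[OF this] show ?thesis
      using vw ww symA[of v w]
      by (simp add: matrix_vector_right_distrib matrix_vector_mult_scaleR inner_add_left
          inner_add_right inner_commute nv M_def power2_eq_square algebra_simps)
  qed
  have "w \<bullet> w = 0"
  proof (rule ccontr)
    assume "w \<bullet> w \<noteq> 0"
    then have pos: "w \<bullet> w > 0" by simp
    define C where "C = \<bar>M * (w \<bullet> w) - w \<bullet> (A *v w)\<bar> + 1"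
    have C: "C > 0" "M * (w \<bullet> w) - w \<bullet> (A *v w) \<le> C" by (auto simp: C_def)
    \<comment> \<open>This step size turns the second-order bound \<open>t^2 * C\<close> into
      \<open>t * (w \<bullet> w)\<close>, half of the first-order term. The summand 1 in
      \<open>C\<close> keeps the denominator positive.\<close>
    define t where "t = (w \<bullet> w) / C"
    have t: "t > 0" using pos C by (simp add: t_def)
    have "2 * t * (w \<bullet> w) \<le> t^2 * C"
      using quad[of t] C(2) by (meson mult_left_mono order_trans zero_le_power2)
    also have "\<dots> = t * (w \<bullet> w)" using C by (simp add: t_def power2_eq_square)
    finally show False using t pos by simp
  qed
  then have "A *v v = (v \<bullet> (A *v v)) *\<^sub>R v" by (simp add: w_def M_def)
  with v that show ?thesis by auto
qed

text \<open>Working with invariant subspaces of a fixed \<open>A\<close> lets the induction on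
  dimension pass to the orthogonal complement of an eigenvector within \<open>W\<close> without ever
  restricting the matrix.\<close>

lemma symmetric_eigenbasis_subspace:
  fixes A :: "real^'n^'n"
  assumes sym: "transpose A = A"
  shows "subspace W \<Longrightarrow> (\<And>x. x \<in> W \<Longrightarrow> A *v x \<in> W) \<Longrightarrow>
    \<exists>B. pairwise orthogonal B \<and> (\<forall>b\<in>B. norm b = 1 \<and> A *v b = (b \<bullet> (A *v b)) *\<^sub>R b) \<and> span B = W"
proof (induction "dim W" arbitrary: W rule: less_induct)
  case less
  show ?case
  proof (cases "W = {0}")
    case True
    then show ?thesis by (intro exI[of _ "{}"]) auto
  next
    case False
    obtain v where v: "v \<in> W" "norm v = 1" "A *v v = (v \<bullet> (A *v v)) *\<^sub>R v"
      using symmetric_eigenvector_in_subspace[OF sym less.prems False] by blast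
    define W' where "W' = {x \<in> W. v \<bullet> x = 0}"
    have sW': "subspace W'"
      using less.prems(1) unfolding W'_def subspace_def by (auto simp: inner_add_right)
    have AW': "A *v x \<in> W'" if "x \<in> W'" for x
    proof -
      have "v \<bullet> (A *v x) = (A *v v) \<bullet> x"
        using inner_transpose_mult[of A v x] sym by simp
      also have "\<dots> = 0" using that by (subst v(3)) (simp add: W'_def)
      finally show ?thesis using that less.prems(2) by (simp add: W'_def)
    qed
    have "v \<notin> W'" using v(2) by (auto simp: W'_def)
    then have "W' \<subset> W" using v(1) unfolding W'_def by blast
    then have "dim W' < dim W"
      using sW' less.prems(1) by (intro dim_psubset) (simp only: span_eq_iff[THEN iffD2])
    from less.hyps[OF this sW' AW'] obtain B where B: "pairwise orthogonal B"
      "\<forall>b\<in>B. norm b = 1 \<and> A *v b = (b \<bullet> (A *v b)) *\<^sub>R b" "span B = W'"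
      by blast
    have BW: "B \<subseteq> W'" using B(3) span_superset by blast
    have "span (insert v B) = W"
    proof
      have "insert v B \<subseteq> W" using BW v(1) by (auto simp: W'_def)
      then show "span (insert v B) \<subseteq> W" using less.prems(1) by (simp add: span_minimal)
      show "W \<subseteq> span (insert v B)"
      proof
        fix x assume x: "x \<in> W"
        have "x - (v \<bullet> x) *\<^sub>R v \<in> W'"
          using x v less.prems(1) by (auto simp: W'_def inner_diff_right norm_eq_1 intro: subspace_diff subspace_scale)
        then show "x \<in> span (insert v B)"
          unfolding span_breakdown_eq B(3) by blast
      qed
    qed
    moreover have "pairwise orthogonal (insert v B)"
      using B(1) BW by (auto simp: pairwise_insert W'_def orthogonal_def inner_commute)
    ultimately show ?thesis using B(2) v by (intro exI[of _ "insert v B"]) auto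
  qed
qed

text \<open>The diagonalisation is carried out over the polynomial ring: real matrices are embedded
  as matrices of constants, where \<open>A ** U = U ** D\<close> survives, and the determinant of
  the embedded \<open>U\<close> cancels because real polynomials form an integral domain.\<close>

lemma charpoly_eigenbasis:
  fixes A :: "real^'n^'n" and u :: "'n \<Rightarrow> real^'n"
  assumes orth: "\<And>i j. u i \<bullet> u j = (if i = j then 1 else 0)"
    and eig: "\<And>i. A *v u i = d i *\<^sub>R u i"
  shows "charpoly A = (\<Prod>i\<in>UNIV. [:- d i, 1:])"
proof -
  define C :: "real^'n^'n \<Rightarrow> real poly^'n^'n" where "C = (\<lambda>M. \<chi> i j. [:M $ i $ j:])"
  define U :: "real^'n^'n" where "U = (\<chi> i j. u j $ i)"
  define D :: "real^'n^'n" where "D = (\<chi> i j. if i = j then d i else 0)"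
  have pc: "(\<Sum>i\<in>S. [:g i:]) = [:\<Sum>i\<in>S. g i:]" for S and g :: "'n \<Rightarrow> real"
    by (induction S rule: infinite_finite_induct) auto
  have C_mult: "C M ** C M' = C (M ** M')" for M M'
    by (simp add: C_def matrix_matrix_mult_def vec_eq_iff pc mult.commute)
  have "transpose U ** U = mat 1"
    using orth by (simp add: U_def matrix_matrix_mult_def mat_def transpose_def vec_eq_iff inner_vec_def)
  then have "C (transpose U) ** C U = mat 1"
    unfolding C_mult by (simp add: C_def mat_def vec_eq_iff)
  then have "det (C (transpose U)) * det (C U) = 1"
    by (metis det_I det_mul)
  then have nz: "det (C U) \<noteq> 0" by auto
  have "A ** U = U ** D"
  proof -
    have "(A ** U) $ i $ j = (U ** D) $ i $ j" for i j
    proof -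
      have "(A ** U) $ i $ j = (A *v u j) $ i"
        by (simp add: U_def matrix_matrix_mult_def matrix_vector_mult_def)
      also have "\<dots> = (U ** D) $ i $ j"
        by (simp add: eig U_def D_def matrix_matrix_mult_def if_distrib cong: if_cong)
      finally show ?thesis .
    qed
    then show ?thesis by (simp add: vec_eq_iff)
  qed
  then have AU: "C A ** C U = C U ** C D" by (simp add: C_mult)
  have X: "mat [:0, 1:] ** M = M ** mat [:0, 1:]" for M :: "real poly^'n^'n"
    by (simp add: matrix_matrix_mult_def mat_def vec_eq_iff if_distrib if_distribR cong: if_cong)
  have "(mat [:0, 1:] - C A) ** C U = mat [:0, 1:] ** C U - C A ** C U"
    by (simp add: matrix_matrix_mult_def vec_eq_iff left_diff_distrib sum_subtractf)
  also have "\<dots> = C U ** mat [:0, 1:] - C U ** C D"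
    by (simp only: AU X)
  also have "\<dots> = C U ** (mat [:0, 1:] - C D)"
    by (simp add: matrix_matrix_mult_def vec_eq_iff right_diff_distrib sum_subtractf)
  finally have "(mat [:0, 1:] - C A) ** C U = C U ** (mat [:0, 1:] - C D)" .
  then have "det (mat [:0, 1:] - C A) * det (C U) = det (C U) * det (mat [:0, 1:] - C D)"
    by (metis det_mul)
  then have "charpoly A = det (mat [:0, 1:] - C D)"
    using nz by (simp add: charpoly_def C_def)
  also have "\<dots> = (\<Prod>i\<in>UNIV. (mat [:0, 1:] - C D) $ i $ i)"
    by (rule det_diagonal) (auto simp: mat_def C_def D_def)
  also have "\<dots> = (\<Prod>i\<in>UNIV. [:- d i, 1:])"
    by (simp add: mat_def C_def D_def)
  finally show ?thesis .
qed

text \<open>This is the bridge from \<open>eigval\<close> to eigenvectors. Indexing by natural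
  numbers rather than by the type \<open>'n\<close> lets the position of a vector record the rank of
  its eigenvalue.\<close>

lemma symmetric_eigval_decomposition:
  fixes A :: "real^'n^'n"
  assumes sym: "transpose A = A"
  obtains u :: "nat \<Rightarrow> real^'n"
  where "\<And>i j. i \<in> {1..CARD('n)} \<Longrightarrow> j \<in> {1..CARD('n)} \<Longrightarrow> u i \<bullet> u j = (if i = j then 1 else 0)"
    and "\<And>j. j \<in> {1..CARD('n)} \<Longrightarrow> A *v u j = eigval j A *\<^sub>R u j"
    and "\<And>i j. 1 \<le> i \<Longrightarrow> i \<le> j \<Longrightarrow> j \<le> CARD('n) \<Longrightarrow> eigval j A \<le> eigval i A"
proof -
  obtain B where B: "pairwise orthogonal B"
    "\<forall>b\<in>B. norm b = 1 \<and> A *v b = (b \<bullet> (A *v b)) *\<^sub>R b" "span B = UNIV"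
    using symmetric_eigenbasis_subspace[OF sym, of UNIV] by auto
  have "0 \<notin> B" using B(2) by auto
  then have ind: "independent B" using B(1) by (simp add: pairwise_orthogonal_independent)
  then have "card B = CARD('n)" using B(3)
    by (metis dim_UNIV dim_span_eq_card_independent DIM_cart DIM_real mult.right_neutral)
  then obtain v :: "'n \<Rightarrow> real^'n" where v: "bij_betw v UNIV B"
    using finite_same_card_bij[of "UNIV :: 'n set" B] ind independent_imp_finite by auto
  define d where "d i = v i \<bullet> (A *v v i)" for i
  have vB: "v i \<in> B" for i using v by (auto simp: bij_betw_def)
  have orth: "v i \<bullet> v j = (if i = j then 1 else 0)" for i j
    using pairwiseD[OF B(1) vB[of i] vB[of j]] B(2) vB[of j] bij_betw_imp_inj_on[OF v]
    by (cases "i = j") (auto simp: inj_on_eq_iff orthogonal_def norm_eq_1)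
  have eig: "A *v v i = d i *\<^sub>R v i" for i using B(2) vB d_def by metis
  have sm: "(\<Sum>i\<in>S. {#d i#}) = image_mset d (mset_set S)" if "finite S" for S
    using that by (induction S) auto
  have "proots (charpoly A) = (\<Sum>i\<in>UNIV. {#d i#})"
    by (simp add: charpoly_eigenbasis[OF orth eig] proots_prod)
  also have "\<dots> = image_mset d (mset_set UNIV)"
    using sm[of UNIV] by simp
  finally have pr: "proots (charpoly A) = image_mset d (mset_set UNIV)" .
  obtain xs :: "'n list" where xs: "set xs = UNIV" "distinct xs"
    using finite_distinct_list[of "UNIV :: 'n set"] by auto
  \<comment> \<open>Sorting the indices by their eigenvalue makes \<open>map d ys\<close> the very
    list of roots that \<open>eigval\<close> reverses, so position \<open>j - 1\<close> of
    \<open>rev ys\<close> names an eigenvector for the \<open>j\<close>-th largest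
    eigenvalue.\<close>
  define ys where "ys = sort_key d xs"
  have ys: "set ys = UNIV" "distinct ys" "sorted (map d ys)"
    using xs by (auto simp: ys_def)
  have len: "length ys = CARD('n)" using ys distinct_card by fastforce
  have "mset_set UNIV = mset ys" using ys by (metis mset_set_set)
  then have "sorted_list_of_multiset (proots (charpoly A)) = sort (map d ys)"
    by (simp add: pr flip: mset_map)
  also have "\<dots> = map d ys" using ys(3) by (rule sorted_sort_id)
  finally have *: "sorted_list_of_multiset (proots (charpoly A)) = map d ys" .
  have ev: "eigval j A = d (rev ys ! (j - 1))" if "j \<in> {1..CARD('n)}" for j
  proof -
    have "j - 1 < length (rev ys)" unfolding length_rev len using that by (metis One_nat_def Suc_pred' atLeastAtMost_iff less_eq_Suc_le)
    then show ?thesis unfolding eigval_def * by (simp add: rev_nth)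
  qed
  show thesis
  proof (rule that[of "\<lambda>j. v (rev ys ! (j - 1))"])
    fix i j :: nat assume "i \<in> {1..CARD('n)}" "j \<in> {1..CARD('n)}"
    then have "rev ys ! (i - 1) = rev ys ! (j - 1) \<longleftrightarrow> i = j"
      using ys(2) len by (subst nth_eq_iff_index_eq) auto
    then show "v (rev ys ! (i - 1)) \<bullet> v (rev ys ! (j - 1)) = (if i = j then 1 else 0)"
      by (simp add: orth)
  next
    fix j assume "j \<in> {1..CARD('n)}"
    then show "A *v v (rev ys ! (j - 1)) = eigval j A *\<^sub>R v (rev ys ! (j - 1))"
      by (simp add: ev eig)
  next
    fix i j :: nat assume ij: "1 \<le> i" "i \<le> j" "j \<le> CARD('n)"
    have "map d ys ! (CARD('n) - j) \<le> map d ys ! (CARD('n) - i)"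
      using ij len by (intro sorted_nth_mono[OF ys(3)]) auto
    then show "eigval j A \<le> eigval i A"
      using ij len by (simp add: ev rev_nth)
  qed
qed


section \<open>Stiefel matrices and their column spaces\<close>

lemma stiefel_eq: "transpose X ** X = mat 1" if "X \<in> stiefel"
  using that by (simp add: stiefel_def)

lemma stiefel_vec_cancel: "transpose X *v (X *v z) = z" if "X \<in> stiefel"
  by (simp only: matrix_vector_mul_assoc stiefel_eq[OF that] matrix_vector_mul_lid)

lemma stiefel_inner: "(X *v y) \<bullet> (X *v z) = y \<bullet> z" if "X \<in> stiefel"
  using inner_transpose_mult[of X "X *v y" z] by (simp only: stiefel_vec_cancel[OF that])

lemma stiefel_norm: "norm (X *v z) = norm z" if "X \<in> stiefel"
  by (simp add: norm_eq_sqrt_inner stiefel_inner[OF that])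

lemma stiefel_column_inner:
  assumes "X \<in> stiefel" shows "column i X \<bullet> column j X = (if i = j then 1 else 0)"
  using stiefel_inner[OF assms, of "axis i 1" "axis j 1"]
  by (simp add: matrix_vector_mult_basis inner_axis_axis)

lemma stiefelI_columns:
  fixes X :: "real^'k^'n"
  assumes "\<And>i j. column i X \<bullet> column j X = (if i = j then 1 else 0)"
  shows "X \<in> stiefel"
  using assms by (simp add: stiefel_def matrix_mult_transpose_dot_column mat_def)

lemma stiefel_square: "X ** transpose X = mat 1" if "X \<in> stiefel" for X :: "real^'k^'k"
  using stiefel_eq[OF that] matrix_left_right_inverse by blast

lemma transpose_stiefel: "transpose X \<in> stiefel" if "X \<in> stiefel" for X :: "real^'k^'k"
  using stiefel_square[OF that] by (simp add: stiefel_def)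

lemma stiefel_mult: "X ** Q \<in> stiefel" if "X \<in> stiefel" "Q \<in> stiefel"
proof -
  have "transpose (X ** Q) ** (X ** Q) = transpose Q ** ((transpose X ** X) ** Q)"
    by (simp add: matrix_transpose_mul matrix_mul_assoc)
  then show ?thesis by (simp add: stiefel_eq[OF that(1)] stiefel_eq[OF that(2)] stiefel_def)
qed

text \<open>Cauchy-Schwarz applied to \<open>y\<close> and its projection
  \<open>X *v (transpose X *v y)\<close>, whose norm is that of \<open>transpose X *v y\<close>
  since \<open>X\<close> is an isometry.\<close>

lemma norm_transpose_stiefel_le: "norm (transpose X *v y) \<le> norm y" if "X \<in> stiefel"
proof -
  have "(norm (transpose X *v y))\<^sup>2 = y \<bullet> (X *v (transpose X *v y))"
    by (simp only: power2_norm_eq_inner inner_transpose_mult)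
  also have "\<dots> \<le> norm y * norm (transpose X *v y)"
    using norm_cauchy_schwarz[of y "X *v (transpose X *v y)"] by (simp only: stiefel_norm[OF that])
  finally show ?thesis
    by (cases "transpose X *v y = 0") (simp_all del: transpose_matrix_vector add: power2_eq_square)
qed

lemma compact_stiefel: "compact (stiefel :: (real^'k^'n) set)"
proof (unfold compact_eq_bounded_closed, intro conjI)
  have "norm X \<le> (\<Sum>i\<in>(UNIV::'n set). \<Sum>j\<in>(UNIV::'k set). 1)" if "X \<in> stiefel" for X :: "real^'k^'n"
  proof -
    have "\<bar>X $ i $ j\<bar> \<le> 1" for i j
    proof -
      have "\<bar>column j X $ i\<bar> \<le> norm (column j X)" by (rule component_le_norm_cart)
      also have "\<dots> = 1" using stiefel_column_inner[OF that, of j j] by (simp add: norm_eq_1)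
      finally show ?thesis by (simp add: column_def)
    qed
    then have "norm (X $ i) \<le> (\<Sum>j\<in>(UNIV::'k set). 1)" for i
      by (intro order.trans[OF norm_le_l1_cart] sum_mono) blast
    then have "(\<Sum>i\<in>UNIV. norm (X $ i)) \<le> (\<Sum>i\<in>(UNIV::'n set). \<Sum>j\<in>(UNIV::'k set). 1)"
      by (intro sum_mono) blast
    moreover have "norm X \<le> (\<Sum>i\<in>UNIV. norm (X $ i))"
      unfolding norm_vec_def by (intro L2_set_le_sum) simp
    ultimately show ?thesis by linarith
  qed
  then show "bounded (stiefel :: (real^'k^'n) set)" unfolding bounded_iff by blast
  have "stiefel = (\<Inter>i. \<Inter>j. {X :: real^'k^'n. (\<Sum>l\<in>UNIV. X $ l $ i * X $ l $ j) = mat 1 $ i $ j})"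
    by (auto simp: stiefel_def vec_eq_iff matrix_matrix_mult_def transpose_def)
  also have "closed \<dots>"
    by (intro closed_INT ballI closed_Collect_eq continuous_intros)
  finally show "closed (stiefel :: (real^'k^'n) set)" .
qed

section \<open>Column spaces of orthonormal basis matrices\<close>

lemma colspace_eq_range: "colspace X = range ((*v) X)" for X :: "real^'k^'n"
proof
  show "colspace X \<subseteq> range ((*v) X)"
    unfolding colspace_def
    by (rule span_minimal) (auto simp: columns_image_basis linear_subspace_image)
  show "range ((*v) X) \<subseteq> colspace X"
    by (auto simp: colspace_def matrix_vector_mult_in_columnspace)
qed

lemma subspace_colspace: "subspace (colspace X)"
  by (simp add: colspace_def)

lemma dim_colspace: "dim (colspace X) = CARD('k)" if "X \<in> stiefel" for X :: "real^'k^'n"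
proof -
  have "inj ((*v) X)"
    by (metis injI stiefel_vec_cancel[OF that])
  then have "dim (range ((*v) X)) = dim (UNIV :: (real^'k) set)"
    by (intro dim_image_eq) (auto simp: inj_on_subset)
  then show ?thesis by (simp add: colspace_eq_range)
qed

lemma colspace_proj:
  assumes "X \<in> stiefel" "y \<in> colspace X"
  shows "X *v (transpose X *v y) = y"
proof -
  obtain z where "y = X *v z" using assms(2) by (auto simp: colspace_eq_range)
  then show ?thesis by (simp only: stiefel_vec_cancel[OF assms(1)])
qed

lemma colspace_subset_imp_eq:
  fixes X Y :: "real^'k^'n"
  assumes "X \<in> stiefel" "Y \<in> stiefel" "colspace Y \<subseteq> colspace X"
  shows "colspace Y = colspace X"
  using assms by (intro subspace_dim_equal) (auto simp: subspace_colspace dim_colspace)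

text \<open>The factor is \<open>transpose X ** Y\<close>: the projector
  \<open>X ** transpose X\<close> fixes every column of \<open>Y\<close>, which gives both the
  factorisation and the orthogonality of the factor.\<close>

lemma colspace_eq_imp_mult:
  fixes X Y :: "real^'k^'n"
  assumes "X \<in> stiefel" "Y \<in> stiefel" "colspace Y = colspace X"
  obtains Q :: "real^'k^'k" where "Q \<in> stiefel" "Y = X ** Q"
proof
  have "X *v (transpose X *v (Y *v z)) = Y *v z" for z
    using assms by (intro colspace_proj) (auto simp: colspace_eq_range)
  then have eq: "X ** (transpose X ** Y) = Y"
    by (simp only: matrix_eq matrix_vector_mul_assoc[symmetric]) simp
  then show "Y = X ** (transpose X ** Y)" by simp
  have "transpose (transpose X ** Y) ** (transpose X ** Y) = transpose Y ** (X ** (transpose X ** Y))"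
    by (simp add: matrix_transpose_mul matrix_mul_assoc)
  also have "\<dots> = mat 1" using assms(2) by (simp only: eq stiefel_eq)
  finally show "transpose X ** Y \<in> stiefel" by (simp add: stiefel_def)
qed

lemma subspace_eq_colspace:
  fixes S :: "(real^'n) set"
  assumes "subspace S" "dim S = CARD('k)"
  obtains X :: "real^'k^'n" where "X \<in> stiefel" "colspace X = S"
proof -
  obtain B where B: "B \<subseteq> S" "pairwise orthogonal B" "\<And>x. x \<in> B \<Longrightarrow> norm x = 1"
    "independent B" "card B = dim S" "span B = S"
    using orthonormal_basis_subspace[OF assms(1)] by blast
  then obtain v :: "'k \<Rightarrow> real^'n" where v: "bij_betw v UNIV B"
    using finite_same_card_bij[of "UNIV :: 'k set" B] independent_imp_finite assms(2) by auto
  define X :: "real^'k^'n" where "X = (\<chi> i j. v j $ i)"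
  have col: "column j X = v j" for j by (simp add: X_def column_def vec_eq_iff)
  have vB: "v i \<in> B" for i using v by (auto simp: bij_betw_def)
  have orth: "v i \<bullet> v j = (if i = j then 1 else 0)" for i j
    using pairwiseD[OF B(2) vB[of i] vB[of j]] B(3) vB[of j] bij_betw_imp_inj_on[OF v]
    by (cases "i = j") (auto simp: inj_on_eq_iff orthogonal_def norm_eq_1)
  have "columns X = B" using v by (auto simp: columns_def col bij_betw_def)
  then have "colspace X = S" using B by (simp add: colspace_def)
  moreover have "X \<in> stiefel" by (rule stiefelI_columns) (simp add: col orth)
  ultimately show thesis using that by blast
qed

section \<open>Trace forms and continuity of matrix operations\<close>

lemma trace_form_eq_columns: "trace_form A X = (\<Sum>c\<in>UNIV. column c X \<bullet> (A *v column c X))"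
proof -
  have "(transpose X ** A ** X) $ c $ c = column c X \<bullet> (A *v column c X)" for c
  proof -
    have "(transpose X ** A ** X) $ c $ c = (transpose X ** (A ** X)) $ c $ c"
      by (simp add: matrix_mul_assoc)
    also have "\<dots> = column c X \<bullet> column c (A ** X)"
      by (simp add: matrix_matrix_mult_def transpose_def inner_vec_def column_def)
    also have "column c (A ** X) = A *v column c X"
      by (simp add: column_def matrix_matrix_mult_def matrix_vector_mult_def vec_eq_iff)
    finally show ?thesis .
  qed
  then show ?thesis by (simp add: trace_form_def trace_def)
qed

text \<open>Cyclicity of the trace leaves \<open>Q ** transpose Q\<close>, the identity since
  \<open>Q\<close> is square. It makes the rotations of the algorithm and of the polar alignment
  invisible to the trace form.\<close>

lemma trace_form_mult: "trace_form A (X ** Q) = trace_form A X" if "Q \<in> stiefel"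
  for X :: "real^'k^'n" and Q :: "real^'k^'k"
proof -
  have "trace_form A (X ** Q) = trace (transpose Q ** (transpose X ** A ** X ** Q))"
    by (simp add: trace_form_def matrix_transpose_mul matrix_mul_assoc)
  also have "\<dots> = trace ((transpose X ** A ** X ** Q) ** transpose Q)"
    by (rule trace_mul_sym)
  also have "\<dots> = trace (transpose X ** A ** X ** (Q ** transpose Q))"
    by (simp add: matrix_mul_assoc)
  finally show ?thesis by (simp add: stiefel_square[OF that] trace_form_def)
qed

lemma tendsto_trace_form:
  assumes "(A \<longlongrightarrow> a) F" "(X \<longlongrightarrow> x) F"
  shows "((\<lambda>i. trace_form (A i) (X i)) \<longlongrightarrow> trace_form a x) F"
  unfolding trace_form_def trace_def matrix_matrix_mult_def transpose_def
  by (simp, intro tendsto_sum tendsto_mult tendsto_vec_nth assms)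

lemma tendsto_matrix_mult:
  fixes A :: "'a \<Rightarrow> real^'m^'n" and B :: "'a \<Rightarrow> real^'k^'m"
  assumes "(A \<longlongrightarrow> a) F" "(B \<longlongrightarrow> b) F"
  shows "((\<lambda>i. A i ** B i) \<longlongrightarrow> a ** b) F"
  unfolding matrix_matrix_mult_def
  by (intro tendsto_vec_lambda tendsto_sum tendsto_mult tendsto_vec_nth assms)

lemma tendsto_transpose:
  fixes A :: "'a \<Rightarrow> real^'m^'n"
  assumes "(A \<longlongrightarrow> a) F"
  shows "((\<lambda>i. transpose (A i)) \<longlongrightarrow> transpose a) F"
  unfolding transpose_def
  by (intro tendsto_vec_lambda tendsto_vec_nth assms)


section \<open>Ky Fan maximum principle\<close>

text \<open>The remainder is orthogonal to a spanning set, hence to itself.\<close>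

lemma orthonormal_expansion:
  fixes u :: "nat \<Rightarrow> real^'n"
  assumes u: "\<And>i j. i \<in> {1..CARD('n)} \<Longrightarrow> j \<in> {1..CARD('n)} \<Longrightarrow> u i \<bullet> u j = (if i = j then 1 else 0)"
  shows "x = (\<Sum>j=1..CARD('n). (u j \<bullet> x) *\<^sub>R u j)"
proof -
  let ?J = "{1..CARD('n)}"
  have inj: "inj_on u ?J"
  proof (rule inj_onI, rule ccontr)
    fix i j assume ij: "i \<in> ?J" "j \<in> ?J" "u i = u j" "i \<noteq> j"
    then show False using u[of i j] u[of j j] by simp
  qed
  have orth: "pairwise orthogonal (u ` ?J)"
    using u by (auto simp: pairwise_def orthogonal_def)
  have "0 \<notin> u ` ?J"
    using u by force
  then have "independent (u ` ?J)"
    using orth by (simp add: pairwise_orthogonal_independent)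
  moreover have "card (u ` ?J) = CARD('n)"
    using inj by (simp add: card_image)
  ultimately have sp: "span (u ` ?J) = UNIV"
    using card_eq_dim[of "u ` ?J" UNIV] by auto
  define y where "y = x - (\<Sum>j\<in>?J. (u j \<bullet> x) *\<^sub>R u j)"
  have "orthogonal y b" if "b \<in> u ` ?J" for b
  proof -
    from that obtain i where i: "i \<in> ?J" "b = u i" by blast
    have "(\<Sum>j\<in>?J. (u j \<bullet> x) * (u j \<bullet> u i)) = (\<Sum>j\<in>?J. if i = j then u i \<bullet> x else 0)"
      using u i by (intro sum.cong) auto
    also have "\<dots> = x \<bullet> u i" using i by (simp add: inner_commute)
    finally show ?thesis
      unfolding i(2) orthogonal_def y_def inner_diff_left inner_sum_left inner_scaleR_left by simp
  qed
  then have "orthogonal y y"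
    using orthogonal_to_span[of y "u ` ?J" y] sp by auto
  then show ?thesis by (simp add: y_def orthogonal_def)
qed

lemma orthonormal_parseval:
  fixes u :: "nat \<Rightarrow> real^'n"
  assumes u: "\<And>i j. i \<in> {1..CARD('n)} \<Longrightarrow> j \<in> {1..CARD('n)} \<Longrightarrow> u i \<bullet> u j = (if i = j then 1 else 0)"
  shows "x \<bullet> x = (\<Sum>j=1..CARD('n). (u j \<bullet> x)\<^sup>2)"
proof -
  have "x \<bullet> x = (\<Sum>j=1..CARD('n). (u j \<bullet> x) *\<^sub>R u j) \<bullet> x"
    by (simp only: orthonormal_expansion[OF u, symmetric])
  then show ?thesis by (simp add: inner_sum_left power2_eq_square)
qed

lemma orthonormal_quadratic_form:
  fixes u :: "nat \<Rightarrow> real^'n"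
  assumes u: "\<And>i j. i \<in> {1..CARD('n)} \<Longrightarrow> j \<in> {1..CARD('n)} \<Longrightarrow> u i \<bullet> u j = (if i = j then 1 else 0)"
    and A: "\<And>j. j \<in> {1..CARD('n)} \<Longrightarrow> A *v u j = e j *\<^sub>R u j"
  shows "x \<bullet> (A *v x) = (\<Sum>j=1..CARD('n). e j * (u j \<bullet> x)\<^sup>2)"
proof -
  have "A *v x = A *v (\<Sum>j=1..CARD('n). (u j \<bullet> x) *\<^sub>R u j)"
    by (simp only: orthonormal_expansion[OF u, symmetric])
  also have "\<dots> = (\<Sum>j=1..CARD('n). (u j \<bullet> x) *\<^sub>R (A *v u j))"
    by (simp add: linear_sum[OF matrix_vector_mul_linear] matrix_vector_mult_scaleR)
  also have "\<dots> = (\<Sum>j=1..CARD('n). (u j \<bullet> x) *\<^sub>R e j *\<^sub>R u j)"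
    by (intro sum.cong) (simp_all add: A)
  finally show ?thesis
    by (simp add: inner_sum_right power2_eq_square inner_commute mult_ac)
qed

lemma norm_transpose_columns: "(norm (transpose X *v y))\<^sup>2 = (\<Sum>c\<in>UNIV. (y \<bullet> column c X)\<^sup>2)"
  for X :: "real^'k^'n"
proof -
  have "(transpose X *v y) $ c = y \<bullet> column c X" for c
    by (simp add: column_def inner_vec_def transpose_def matrix_vector_mult_def mult.commute
        del: transpose_matrix_vector)
  then show ?thesis
    unfolding power2_norm_eq_inner inner_vec_def[of "transpose X *v y"] by (simp add: power2_eq_square del: transpose_matrix_vector)
qed

text \<open>The trace form becomes a weighted sum of eigenvalues; the weight of \<open>u j\<close>
  is the squared length of its projection onto the column space when \<open>X\<close> is
  orthonormal. This reduces Ky Fan's principle to a statement about weights.\<close>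

lemma trace_form_eigen:
  fixes u :: "nat \<Rightarrow> real^'n" and X :: "real^'k^'n"
  assumes u: "\<And>i j. i \<in> {1..CARD('n)} \<Longrightarrow> j \<in> {1..CARD('n)} \<Longrightarrow> u i \<bullet> u j = (if i = j then 1 else 0)"
    and A: "\<And>j. j \<in> {1..CARD('n)} \<Longrightarrow> A *v u j = e j *\<^sub>R u j"
  shows "trace_form A X = (\<Sum>j=1..CARD('n). e j * (norm (transpose X *v u j))\<^sup>2)"
proof -
  have "trace_form A X = (\<Sum>c\<in>UNIV. \<Sum>j=1..CARD('n). e j * (u j \<bullet> column c X)\<^sup>2)"
    unfolding trace_form_eq_columns by (intro sum.cong refl orthonormal_quadratic_form u A)
  also have "\<dots> = (\<Sum>j=1..CARD('n). \<Sum>c\<in>UNIV. e j * (u j \<bullet> column c X)\<^sup>2)"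
    by (rule sum.swap)
  finally show ?thesis
    by (simp only: norm_transpose_columns sum_distrib_left)
qed

lemma sum_norm_transpose_stiefel:
  fixes u :: "nat \<Rightarrow> real^'n" and X :: "real^'k^'n"
  assumes u: "\<And>i j. i \<in> {1..CARD('n)} \<Longrightarrow> j \<in> {1..CARD('n)} \<Longrightarrow> u i \<bullet> u j = (if i = j then 1 else 0)"
    and X: "X \<in> stiefel"
  shows "(\<Sum>j=1..CARD('n). (norm (transpose X *v u j))\<^sup>2) = CARD('k)"
proof -
  have "(\<Sum>j=1..CARD('n). (norm (transpose X *v u j))\<^sup>2)
      = (\<Sum>c\<in>UNIV. \<Sum>j=1..CARD('n). (u j \<bullet> column c X)\<^sup>2)"
    unfolding norm_transpose_columns by (rule sum.swap)
  also have "\<dots> = (\<Sum>c\<in>(UNIV :: 'k set). column c X \<bullet> column c X)"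
    by (simp only: orthonormal_parseval[OF u])
  finally show ?thesis by (simp add: stiefel_column_inner[OF X])
qed

lemma trace_eq_sum_eigval:
  fixes A :: "real^'n^'n"
  assumes "transpose A = A"
  shows "trace A = (\<Sum>j=1..CARD('n). eigval j A)"
proof -
  obtain u :: "nat \<Rightarrow> real^'n"
    where u: "\<And>i j. i \<in> {1..CARD('n)} \<Longrightarrow> j \<in> {1..CARD('n)} \<Longrightarrow> u i \<bullet> u j = (if i = j then 1 else 0)"
      and A: "\<And>j. j \<in> {1..CARD('n)} \<Longrightarrow> A *v u j = eigval j A *\<^sub>R u j"
    using symmetric_eigval_decomposition[OF assms] by metis
  have "trace A = trace_form A (mat 1 :: real^'n^'n)"
    by (simp add: trace_form_def)
  also have "\<dots> = (\<Sum>j=1..CARD('n). eigval j A * (norm (u j))\<^sup>2)"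
    using trace_form_eigen[OF u A, of "mat 1 :: real^'n^'n"] by simp
  also have "\<dots> = (\<Sum>j=1..CARD('n). eigval j A)"
    by (intro sum.cong) (simp_all add: power2_norm_eq_inner u)
  finally show ?thesis .
qed

text \<open>The weights lie in the unit interval and sum to \<open>CARD('k)\<close>. Whatever weight
  \<open>W\<close> sits beyond the first \<open>CARD('k)\<close> eigenvectors is missing among them,
  and every unit so displaced costs at least the spectral gap. Keeping this loss explicit yields
  both the maximum principle and the uniqueness of the maximising subspace.\<close>

lemma ky_fan_gap:
  fixes u :: "nat \<Rightarrow> real^'n" and X :: "real^'k^'n"
  assumes u: "\<And>i j. i \<in> {1..CARD('n)} \<Longrightarrow> j \<in> {1..CARD('n)} \<Longrightarrow> u i \<bullet> u j = (if i = j then 1 else 0)"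
    and A: "\<And>j. j \<in> {1..CARD('n)} \<Longrightarrow> A *v u j = e j *\<^sub>R u j"
    and e: "\<And>i j. 1 \<le> i \<Longrightarrow> i \<le> j \<Longrightarrow> j \<le> CARD('n) \<Longrightarrow> e j \<le> e i"
    and k: "CARD('k) < CARD('n)" and X: "X \<in> stiefel"
  shows "trace_form A X + (e CARD('k) - e (CARD('k) + 1))
       * (\<Sum>j=CARD('k)+1..CARD('n). (norm (transpose X *v u j))\<^sup>2) \<le> (\<Sum>j=1..CARD('k). e j)"
proof -
  define k n where "k = CARD('k)" and "n = CARD('n)"
  have kn: "1 \<le> k" "k < n" using k by (auto simp: k_def n_def)
  define w where "w j = (norm (transpose X *v u j))\<^sup>2" for j
  define W where "W = (\<Sum>j=k+1..n. w j)"
  have w0: "0 \<le> w j" for j by (simp add: w_def)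
  have w1: "w j \<le> 1" if "j \<in> {1..n}" for j
  proof -
    have "norm (transpose X *v u j) \<le> norm (u j)" by (rule norm_transpose_stiefel_le[OF X])
    also have "\<dots> = 1" using u[of j j] that by (simp add: norm_eq_1 n_def)
    finally show ?thesis unfolding w_def by (simp add: power_le_one)
  qed
  have split: "(\<Sum>j=1..n. g j) = (\<Sum>j=1..k. g j) + (\<Sum>j=k+1..n. g j)" for g :: "nat \<Rightarrow> real"
    using sum.ub_add_nat[of 1 k g "n - k"] kn by simp
  have "(\<Sum>j=1..n. w j) = k"
    unfolding w_def k_def n_def by (rule sum_norm_transpose_stiefel[OF u X])
  then have sw: "(\<Sum>j=1..k. w j) = k - W" using split[of w] by (simp add: W_def)
  have "trace_form A X = (\<Sum>j=1..k. e j * w j) + (\<Sum>j=k+1..n. e j * w j)"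
    unfolding split[of "\<lambda>j. e j * w j", symmetric] unfolding w_def n_def by (rule trace_form_eigen[OF u A])
  also have "(\<Sum>j=1..k. e j * w j) \<le> (\<Sum>j=1..k. e j - e k * (1 - w j))"
  proof (rule sum_mono)
    fix j assume j: "j \<in> {1..k}"
    \<comment> \<open>Missing weight \<open>1 - w j\<close> at a leading eigenvalue is charged only
      at the rate \<open>e k\<close>; summed over \<open>j\<close> it amounts to
      \<open>e k * W\<close>.\<close>
    then have "0 \<le> (e j - e k) * (1 - w j)"
      using e[of j k] w1[of j] kn by (intro mult_nonneg_nonneg) (auto simp: n_def)
    then show "e j * w j \<le> e j - e k * (1 - w j)" by (simp add: algebra_simps)
  qed
  also have "(\<Sum>j=1..k. e j - e k * (1 - w j)) = (\<Sum>j=1..k. e j) - e k * W"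
    using sw by (simp add: sum_subtractf flip: sum_distrib_left)
  also have "(\<Sum>j=k+1..n. e j * w j) \<le> (\<Sum>j=k+1..n. e (k + 1) * w j)"
    using e[of "k + 1"] kn w0 by (intro sum_mono mult_right_mono) (auto simp: n_def)
  also have "\<dots> = e (k + 1) * W" by (simp add: W_def sum_distrib_left)
  finally have "trace_form A X + (e k - e (k + 1)) * W \<le> (\<Sum>j=1..k. e j)"
    by (simp add: algebra_simps)
  then show ?thesis by (simp add: W_def w_def k_def n_def)
qed

lemma ky_fan:
  fixes A :: "real^'n^'n" and X :: "real^'k^'n"
  assumes sym: "transpose A = A" and k: "CARD('k) < CARD('n)" and X: "X \<in> stiefel"
  shows "trace_form A X \<le> (\<Sum>j=1..CARD('k). eigval j A)"
proof -
  obtain u :: "nat \<Rightarrow> real^'n"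
    where u: "\<And>i j. i \<in> {1..CARD('n)} \<Longrightarrow> j \<in> {1..CARD('n)} \<Longrightarrow> u i \<bullet> u j = (if i = j then 1 else 0)"
      and A: "\<And>j. j \<in> {1..CARD('n)} \<Longrightarrow> A *v u j = eigval j A *\<^sub>R u j"
      and e: "\<And>i j. 1 \<le> i \<Longrightarrow> i \<le> j \<Longrightarrow> j \<le> CARD('n) \<Longrightarrow> eigval j A \<le> eigval i A"
    using symmetric_eigval_decomposition[OF sym] by metis
  have "0 \<le> (eigval CARD('k) A - eigval (CARD('k) + 1) A)
       * (\<Sum>j=CARD('k)+1..CARD('n). (norm (transpose X *v u j))\<^sup>2)"
    using e[of "CARD('k)" "CARD('k) + 1"] k by (intro mult_nonneg_nonneg sum_nonneg) (auto simp: Suc_le_eq)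
  then show ?thesis using ky_fan_gap[OF u A e k X] by linarith
qed

lemma ky_fan_attained:
  fixes A :: "real^'n^'n"
  assumes sym: "transpose A = A" and k: "CARD('k) < CARD('n)"
  obtains X :: "real^'k^'n" where "X \<in> stiefel" "trace_form A X = (\<Sum>j=1..CARD('k). eigval j A)"
proof -
  obtain u :: "nat \<Rightarrow> real^'n"
    where u: "\<And>i j. i \<in> {1..CARD('n)} \<Longrightarrow> j \<in> {1..CARD('n)} \<Longrightarrow> u i \<bullet> u j = (if i = j then 1 else 0)"
      and A: "\<And>j. j \<in> {1..CARD('n)} \<Longrightarrow> A *v u j = eigval j A *\<^sub>R u j"
    using symmetric_eigval_decomposition[OF sym] by metis
  obtain b :: "'k \<Rightarrow> nat" where b: "bij_betw b UNIV {1..CARD('k)}"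
    using finite_same_card_bij[of "UNIV :: 'k set" "{1..CARD('k)}"] by auto
  have bin: "b c \<in> {1..CARD('n)}" for c
    using bij_betwE[OF b] k by (auto dest!: spec[of _ c] intro: order.trans)
  define X :: "real^'k^'n" where "X = (\<chi> i c. u (b c) $ i)"
  have col: "column c X = u (b c)" for c by (simp add: X_def column_def vec_eq_iff)
  have "X \<in> stiefel"
    using bij_betw_imp_inj_on[OF b] by (intro stiefelI_columns) (simp add: col u[OF bin bin] inj_on_eq_iff)
  moreover have "trace_form A X = (\<Sum>c\<in>UNIV. eigval (b c) A)"
    unfolding trace_form_eq_columns col A[OF bin] by (simp add: u[OF bin bin])
  moreover have "\<dots> = (\<Sum>j=1..CARD('k). eigval j A)"
    by (rule sum.reindex_bij_betw[OF b])
  ultimately show thesis using that by simp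
qed

text \<open>The matrix \<open>L\<close> is forced to be \<open>transpose X ** (A ** X)\<close>.
  Hence it is symmetric, and its trace is the sum of its eigenvalues, which are the leading ones of
  \<open>A\<close>.\<close>

lemma trace_form_top_eigenspace_basis:
  fixes A :: "real^'n^'n" and X :: "real^'k^'n"
  assumes sym: "transpose A = A" and X: "top_eigenspace_basis A X"
  shows "trace_form A X = (\<Sum>j=1..CARD('k). eigval j A)"
proof -
  obtain L :: "real^'k^'k" where XS: "X \<in> stiefel" and L: "A ** X = X ** L"
    and ev: "\<And>j. j \<in> {1..CARD('k)} \<Longrightarrow> eigval j L = eigval j A"
    using X by (auto simp: top_eigenspace_basis_def)
  have "transpose X ** (A ** X) = (transpose X ** X) ** L"
    by (simp add: L matrix_mul_assoc)
  then have LX: "L = transpose X ** (A ** X)" by (simp add: stiefel_eq[OF XS])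
  then have "transpose L = L"
    by (simp add: matrix_transpose_mul matrix_mul_assoc sym)
  then have "trace L = (\<Sum>j=1..CARD('k). eigval j L)" by (rule trace_eq_sum_eigval)
  then show ?thesis using ev by (simp add: trace_form_def LX matrix_mul_assoc)
qed

text \<open>With a positive gap a maximiser can place no weight on the trailing eigenvectors. Its
  column space then lies in the span \<open>E\<close> of the leading ones and fills it by dimension,
  so all maximisers share \<open>E\<close>.\<close>

lemma ky_fan_unique:
  fixes A :: "real^'n^'n" and X Y :: "real^'k^'n"
  assumes sym: "transpose A = A" and k: "CARD('k) < CARD('n)"
    and gap: "eigval CARD('k) A - eigval (CARD('k) + 1) A > 0"
    and X: "X \<in> stiefel" "\<And>Z :: real^'k^'n. Z \<in> stiefel \<Longrightarrow> trace_form A Z \<le> trace_form A X"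
    and Y: "Y \<in> stiefel" "trace_form A Y = trace_form A X"
  shows "colspace Y = colspace X"
proof -
  obtain u :: "nat \<Rightarrow> real^'n"
    where u: "\<And>i j. i \<in> {1..CARD('n)} \<Longrightarrow> j \<in> {1..CARD('n)} \<Longrightarrow> u i \<bullet> u j = (if i = j then 1 else 0)"
      and A: "\<And>j. j \<in> {1..CARD('n)} \<Longrightarrow> A *v u j = eigval j A *\<^sub>R u j"
      and e: "\<And>i j. 1 \<le> i \<Longrightarrow> i \<le> j \<Longrightarrow> j \<le> CARD('n) \<Longrightarrow> eigval j A \<le> eigval i A"
    using symmetric_eigval_decomposition[OF sym] by metis
  \<comment> \<open>The matrix of leading eigenvectors is a competitor, so a maximiser reaches at
    least the eigenvalue sum.\<close>
  have max: "(\<Sum>j=1..CARD('k). eigval j A) \<le> trace_form A X"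
    using ky_fan_attained[OF sym k] X(2) by metis
  define E where "E = span (u ` {1..CARD('k)})"
  have "colspace Z = E" if Z: "Z \<in> stiefel" "trace_form A Z = trace_form A X" for Z :: "real^'k^'n"
  proof -
    let ?W = "\<Sum>j=CARD('k)+1..CARD('n). (norm (transpose Z *v u j))\<^sup>2"
    have "(eigval CARD('k) A - eigval (CARD('k) + 1) A) * ?W \<le> 0"
      using ky_fan_gap[OF u A e k Z(1)] max Z(2) by linarith
    then have "?W \<le> 0" using gap by (simp only: mult_le_0_iff) linarith
    then have "?W = 0" by (intro order.antisym sum_nonneg) auto
    then have z: "transpose Z *v u j = 0" if "j \<in> {CARD('k)+1..CARD('n)}" for j
      using that by (subst (asm) sum_nonneg_eq_0_iff) (auto simp del: transpose_matrix_vector)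
    have "colspace Z \<subseteq> E"
    proof
      fix x assume "x \<in> colspace Z"
      then obtain y where y: "x = Z *v y" by (auto simp: colspace_eq_range)
      have ux: "u j \<bullet> x = 0" if "j \<in> {CARD('k)+1..CARD('n)}" for j
        using inner_transpose_mult[of Z "u j" y] y z[OF that] by simp
      have "(\<Sum>j=1..CARD('n). (u j \<bullet> x) *\<^sub>R u j) \<in> E"
      proof (intro subspace_sum)
        show "subspace E" by (simp add: E_def)
        fix j assume j: "j \<in> {1..CARD('n)}"
        show "(u j \<bullet> x) *\<^sub>R u j \<in> E"
        proof (cases "j \<le> CARD('k)")
          case True
          then show ?thesis using j unfolding E_def by (intro span_scale span_base) auto
        next
          case False
          then show ?thesis using j ux[of j] by (simp add: E_def span_zero)
        qed
      qed
      then show "x \<in> E" by (simp only: orthonormal_expansion[OF u, symmetric])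
    qed
    moreover have "dim E \<le> dim (colspace Z)"
    proof -
      have "dim E \<le> card (u ` {1..CARD('k)})"
        unfolding E_def dim_span by (intro dim_le_card') auto
      also have "\<dots> \<le> CARD('k)" using card_image_le[of "{1..CARD('k)}" u] by simp
      finally show ?thesis by (simp add: dim_colspace[OF Z(1)])
    qed
    ultimately show ?thesis
      by (intro subspace_dim_equal) (auto simp: subspace_colspace E_def)
  qed
  then show ?thesis using X(1) Y by simp
qed


section \<open>The metric on the Grassmannian\<close>

text \<open>For orthonormal \<open>X\<close> and \<open>Y\<close> this is the sine of the largest
  canonical angle, written as the operator norm of \<open>Y\<close> followed by the projection onto
  the orthogonal complement of \<open>colspace X\<close>. In this form the metric axioms become
  estimates on vectors.\<close>

definition subspace_gap :: "real^'k^'n \<Rightarrow> real^'k^'n \<Rightarrow> real" where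
  "subspace_gap X Y = onorm (\<lambda>z. Y *v z - X *v (transpose X *v (Y *v z)))"

lemma linear_gap_residual: "linear (\<lambda>z. Y *v z - X *v (transpose X *v (Y *v z)))" for X Y :: "real^'k^'n"
  by (intro linearI)
    (simp_all del: transpose_matrix_vector add: matrix_vector_right_distrib matrix_vector_mult_scaleR algebra_simps)

lemma subspace_gap_bound:
  "norm (Y *v z - X *v (transpose X *v (Y *v z))) \<le> subspace_gap X Y * norm z"
  for X Y :: "real^'k^'n"
  unfolding subspace_gap_def
  using onorm[OF linear_conv_bounded_linear[THEN iffD1, OF linear_gap_residual]] by blast

lemma subspace_gap_nonneg: "0 \<le> subspace_gap X Y"
  unfolding subspace_gap_def
  using onorm_pos_le[OF linear_conv_bounded_linear[THEN iffD1, OF linear_gap_residual]] by blast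

lemma subspace_gap_le:
  assumes "\<And>z. norm (Y *v z - X *v (transpose X *v (Y *v z))) \<le> b * norm z"
  shows "subspace_gap X Y \<le> b"
  unfolding subspace_gap_def by (intro onorm_le assms)

text \<open>Pythagoras for the orthogonal projection onto \<open>colspace X\<close>.\<close>

lemma norm_residual:
  assumes "X \<in> stiefel"
  shows "(norm (y - X *v (transpose X *v y)))\<^sup>2 = (norm y)\<^sup>2 - (norm (transpose X *v y))\<^sup>2"
proof -
  let ?t = "transpose X *v y"
  have 1: "(X *v ?t) \<bullet> y = ?t \<bullet> ?t"
    using inner_transpose_mult[of X y ?t] by (simp only: inner_commute)
  have 2: "(X *v ?t) \<bullet> (X *v ?t) = ?t \<bullet> ?t" by (rule stiefel_inner[OF assms])
  show ?thesis
    unfolding power2_norm_eq_inner inner_diff_left inner_diff_right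
    by (simp only: 1 2 inner_commute[of y "X *v ?t"])
qed

lemma norm_residual_le:
  assumes "X \<in> stiefel" shows "norm (y - X *v (transpose X *v y)) \<le> norm y"
  by (rule power2_le_imp_le) (simp_all add: norm_residual[OF assms] del: transpose_matrix_vector)

lemma subspace_gap_bound_sq:
  assumes "X \<in> stiefel" "Y \<in> stiefel"
  shows "(1 - (subspace_gap X Y)\<^sup>2) * (norm z)\<^sup>2 \<le> (norm (transpose X *v (Y *v z)))\<^sup>2"
proof -
  have "(norm (Y *v z - X *v (transpose X *v (Y *v z))))\<^sup>2 \<le> (subspace_gap X Y * norm z)\<^sup>2"
    by (intro power_mono subspace_gap_bound) simp
  then show ?thesis
    unfolding norm_residual[OF assms(1)] stiefel_norm[OF assms(2)]
    by (simp add: power_mult_distrib left_diff_distrib del: transpose_matrix_vector)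
qed

text \<open>
  Both gaps are governed by the square matrix \<open>X\<^sup>T Y\<close> and its transpose, which share any positive lower
  bound of the form \<open>s * norm v \<le> norm (B *v v)\<close>.
\<close>

lemma subspace_gap_commute_le:
  fixes X Y :: "real^'k^'n"
  assumes X: "X \<in> stiefel" and Y: "Y \<in> stiefel"
  shows "subspace_gap Y X \<le> subspace_gap X Y"
proof (rule subspace_gap_le)
  fix z :: "real^'k"
  define d where "d = subspace_gap X Y"
  define B where "B = transpose X ** Y"
  have d0: "0 \<le> d" by (simp add: d_def subspace_gap_nonneg)
  have B: "(1 - d\<^sup>2) * (norm v)\<^sup>2 \<le> (norm (B *v v))\<^sup>2" for v
    using subspace_gap_bound_sq[OF X Y] by (simp only: d_def B_def matrix_vector_mul_assoc)
  have BT: "transpose Y *v (X *v v) = transpose B *v v" for v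
    by (simp add: B_def matrix_transpose_mul matrix_vector_mul_assoc del: transpose_matrix_vector)
  have "(1 - d\<^sup>2) * (norm z)\<^sup>2 \<le> (norm (transpose B *v z))\<^sup>2"
  \<comment> \<open>If the factor is not positive the bound is trivial; otherwise its root
    \<open>s\<close> is a positive lower bound for the stretching of \<open>B\<close>.\<close>
  proof (cases "1 - d\<^sup>2 \<le> 0")
    case True
    then have "(1 - d\<^sup>2) * (norm z)\<^sup>2 \<le> 0" by (simp add: mult_nonpos_nonneg)
    then show ?thesis by (meson order.trans zero_le_power2)
  next
    case False
    define s where "s = sqrt (1 - d\<^sup>2)"
    have s: "s > 0" "s\<^sup>2 = 1 - d\<^sup>2" using False by (auto simp: s_def)
    have Bs: "s * norm v \<le> norm (B *v v)" for v
      by (rule power2_le_imp_le) (use B[of v] in \<open>simp_all add: power_mult_distrib s(2)\<close>)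
    have "inj ((*v) B)"
    proof (rule injI)
      fix x y assume "B *v x = B *v y"
      then have "norm (x - y) \<le> 0"
        using Bs[of "x - y"] s(1) by (simp add: matrix_vector_mult_diff_distrib mult_le_0_iff)
      then show "x = y" by simp
    qed
    \<comment> \<open>Here it matters that \<open>B\<close> is square: injectivity gives a preimage
      \<open>v\<close> of \<open>z\<close>, and pairing \<open>z\<close> with \<open>B *v v\<close>
      transfers the lower bound from \<open>B\<close> to its transpose.\<close>
    then have "surj ((*v) B)" by (rule linear_injective_imp_surjective[OF matrix_vector_mul_linear]) simp
    then obtain v where v: "z = B *v v" by (metis surjD)
    have "norm z * norm z = (transpose B *v z) \<bullet> v"
      unfolding inner_transpose_mult v[symmetric] by (simp add: power2_norm_eq_inner flip: power2_eq_square)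
    also have "\<dots> \<le> norm (transpose B *v z) * norm v" by (rule norm_cauchy_schwarz)
    finally have "s * (norm z * norm z) \<le> norm (transpose B *v z) * (s * norm v)"
      using s(1) by (simp add: mult.left_commute del: transpose_matrix_vector)
    also have "\<dots> \<le> norm (transpose B *v z) * norm z"
      using Bs[of v] v by (intro mult_left_mono) auto
    finally have "s * norm z \<le> norm (transpose B *v z)"
      by (cases "z = 0") (auto simp del: transpose_matrix_vector)
    then have "(s * norm z)\<^sup>2 \<le> (norm (transpose B *v z))\<^sup>2"
      using s(1) by (intro power_mono) auto
    then show ?thesis by (simp only: power_mult_distrib s(2))
  qed
  then have "(norm (X *v z - Y *v (transpose Y *v (X *v z))))\<^sup>2 \<le> (d * norm z)\<^sup>2"
    unfolding norm_residual[OF Y] stiefel_norm[OF X] unfolding BT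
    by (simp add: power_mult_distrib left_diff_distrib del: transpose_matrix_vector)
  then show "norm (X *v z - Y *v (transpose Y *v (X *v z))) \<le> subspace_gap X Y * norm z"
    unfolding d_def[symmetric] by (rule power2_le_imp_le) (simp add: d0)
qed

lemma subspace_gap_commute:
  assumes "X \<in> stiefel" "Y \<in> stiefel"
  shows "subspace_gap Y X = subspace_gap X Y"
  using subspace_gap_commute_le[OF assms] subspace_gap_commute_le[OF assms(2,1)] by simp

text \<open>\<open>Z *v z\<close> splits into its projection \<open>Y *v t\<close> and a remainder
  \<open>r\<close>. The complementary projection of \<open>X\<close> is linear and contractive, so
  \<open>r\<close> contributes at most the gap from \<open>Y\<close> to \<open>Z\<close>, and
  \<open>Y *v t\<close> at most the gap from \<open>X\<close> to \<open>Y\<close>.\<close>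

lemma subspace_gap_triangle:
  fixes X Y Z :: "real^'k^'n"
  assumes X: "X \<in> stiefel" and Y: "Y \<in> stiefel" and Z: "Z \<in> stiefel"
  shows "subspace_gap X Z \<le> subspace_gap X Y + subspace_gap Y Z"
proof (rule subspace_gap_le)
  fix z :: "real^'k"
  define t where "t = transpose Y *v (Z *v z)"
  define r where "r = Z *v z - Y *v t"
  have nt: "norm t \<le> norm z"
    using norm_transpose_stiefel_le[OF Y, of "Z *v z"] by (simp only: t_def stiefel_norm[OF Z])
  have "Z *v z - X *v (transpose X *v (Z *v z))
      = (r - X *v (transpose X *v r)) + (Y *v t - X *v (transpose X *v (Y *v t)))"
    unfolding r_def by (simp only: matrix_vector_mult_diff_distrib) simp
  then have "norm (Z *v z - X *v (transpose X *v (Z *v z)))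
      \<le> norm (r - X *v (transpose X *v r)) + norm (Y *v t - X *v (transpose X *v (Y *v t)))"
    by (simp only: norm_triangle_ineq)
  also have "norm (r - X *v (transpose X *v r)) \<le> norm r" by (rule norm_residual_le[OF X])
  also have "norm r \<le> subspace_gap Y Z * norm z"
    unfolding r_def t_def by (rule subspace_gap_bound)
  also have "norm (Y *v t - X *v (transpose X *v (Y *v t))) \<le> subspace_gap X Y * norm t"
    by (rule subspace_gap_bound)
  also have "\<dots> \<le> subspace_gap X Y * norm z"
    by (intro mult_left_mono nt subspace_gap_nonneg)
  finally show "norm (Z *v z - X *v (transpose X *v (Z *v z))) \<le> (subspace_gap X Y + subspace_gap Y Z) * norm z"
    by (simp add: distrib_right add.commute del: transpose_matrix_vector)
qed

lemma subspace_gap_eq_0_iff: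
  fixes X Y :: "real^'k^'n"
  assumes X: "X \<in> stiefel" and Y: "Y \<in> stiefel"
  shows "subspace_gap X Y = 0 \<longleftrightarrow> colspace X = colspace Y"
proof
  assume 0: "subspace_gap X Y = 0"
  have "Y *v z \<in> colspace X" for z
  proof -
    have "Y *v z = X *v (transpose X *v (Y *v z))"
      using subspace_gap_bound[of Y z X] by (simp add: 0 del: transpose_matrix_vector)
    then show ?thesis unfolding colspace_eq_range by (rule range_eqI[where f="(*v) X"])
  qed
  then have "colspace Y \<subseteq> colspace X" by (auto simp: colspace_eq_range[of Y])
  then show "colspace X = colspace Y" using colspace_subset_imp_eq[OF X Y] by simp
next
  assume eq: "colspace X = colspace Y"
  have "X *v (transpose X *v (Y *v z)) = Y *v z" for z
    by (rule colspace_proj[OF X]) (simp only: eq, simp add: colspace_eq_range)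
  then have "subspace_gap X Y \<le> 0"
    by (intro subspace_gap_le) (simp del: transpose_matrix_vector)
  then show "subspace_gap X Y = 0" using subspace_gap_nonneg[of X Y] by simp
qed

text \<open>Changing a basis moves by gap zero, so the triangle inequality gives both directions.
  This is what makes the description in \<open>dist2\<close> independent of the chosen
  bases.\<close>

lemma subspace_gap_cong:
  fixes X Y X' Y' :: "real^'k^'n"
  assumes st: "X \<in> stiefel" "Y \<in> stiefel" "X' \<in> stiefel" "Y' \<in> stiefel"
    and eq: "colspace X' = colspace X" "colspace Y' = colspace Y"
  shows "subspace_gap X' Y' = subspace_gap X Y"
proof -
  have "subspace_gap X' X = 0" "subspace_gap X X' = 0" "subspace_gap Y' Y = 0" "subspace_gap Y Y' = 0"
    using st eq by (simp_all add: subspace_gap_eq_0_iff)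
  then show ?thesis
    using subspace_gap_triangle[of X' X Y'] subspace_gap_triangle[of X Y Y']
      subspace_gap_triangle[of X X' Y] subspace_gap_triangle[of X' Y' Y] st by fastforce
qed

text \<open>The complementary projection annihilates the range of \<open>X\<close>, so the residual
  of \<open>Y i\<close> is that of \<open>Y i - X\<close>, which is controlled by the entries of the
  difference.\<close>

lemma tendsto_subspace_gap:
  fixes X :: "real^'k^'n"
  assumes X: "X \<in> stiefel" and lim: "(Y \<longlongrightarrow> X) F"
  shows "((\<lambda>i. subspace_gap X (Y i)) \<longlongrightarrow> 0) F"
proof (rule tendsto_sandwich)
  show "\<forall>\<^sub>F i in F. 0 \<le> subspace_gap X (Y i)" by (simp add: subspace_gap_nonneg)
  have "subspace_gap X (Y i) \<le> (\<Sum>a\<in>UNIV. \<Sum>b\<in>UNIV. \<bar>(Y i - X) $ a $ b\<bar>)" for i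
  proof (rule order.trans[OF subspace_gap_le onorm_le_matrix_component_sum])
    fix z :: "real^'k"
    let ?r = "(Y i - X) *v z"
    have "Y i *v z - X *v (transpose X *v (Y i *v z)) = ?r - X *v (transpose X *v ?r)"
      by (simp only: matrix_vector_mult_diff_rdistrib matrix_vector_mult_diff_distrib stiefel_vec_cancel[OF X]) simp
    then have "norm (Y i *v z - X *v (transpose X *v (Y i *v z))) \<le> norm ?r"
      using norm_residual_le[OF X, of ?r] by (simp only:)
    also have "\<dots> \<le> onorm ((*v) (Y i - X)) * norm z"
      by (rule onorm) (rule matrix_vector_mul_bounded_linear)
    finally show "norm (Y i *v z - X *v (transpose X *v (Y i *v z))) \<le> onorm ((*v) (Y i - X)) * norm z" .
  qed
  then show "\<forall>\<^sub>F i in F. subspace_gap X (Y i) \<le> (\<Sum>a\<in>UNIV. \<Sum>b\<in>UNIV. \<bar>(Y i - X) $ a $ b\<bar>)"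
    by simp
  have "((\<lambda>i. \<Sum>a\<in>UNIV. \<Sum>b\<in>UNIV. \<bar>(Y i - X) $ a $ b\<bar>) \<longlongrightarrow> (\<Sum>a\<in>UNIV. \<Sum>b\<in>UNIV. \<bar>(X - X) $ a $ b\<bar>)) F"
    by (intro tendsto_sum tendsto_rabs tendsto_vec_nth tendsto_diff lim tendsto_const)
  then show "((\<lambda>i. \<Sum>a\<in>UNIV. \<Sum>b\<in>UNIV. \<bar>(Y i - X) $ a $ b\<bar>) \<longlongrightarrow> 0) F" by simp
qed simp

text \<open>The squared singular values of \<open>transpose X ** Y\<close> are the eigenvalues of
  \<open>C\<close>, whose quadratic form is the squared length of the projected vector. The largest
  angle belongs to the smallest eigenvalue, and by Pythagoras the residual is longest in that same
  direction.\<close>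

lemma Max_sin_canonical_angle:
  fixes X Y :: "real^'k^'n"
  assumes X: "X \<in> stiefel" and Y: "Y \<in> stiefel"
  shows "Max ((\<lambda>j. sin (canonical_angle j X Y)) ` {1..CARD('k)}) = subspace_gap X Y"
proof -
  define B where "B = transpose X ** Y"
  define C where "C = transpose B ** B"
  have "transpose C = C" by (simp add: C_def matrix_transpose_mul)
  then obtain u :: "nat \<Rightarrow> real^'k"
    where u: "\<And>i j. i \<in> {1..CARD('k)} \<Longrightarrow> j \<in> {1..CARD('k)} \<Longrightarrow> u i \<bullet> u j = (if i = j then 1 else 0)"
      and eig: "\<And>j. j \<in> {1..CARD('k)} \<Longrightarrow> C *v u j = eigval j C *\<^sub>R u j"
      and anti: "\<And>i j. 1 \<le> i \<Longrightarrow> i \<le> j \<Longrightarrow> j \<le> CARD('k) \<Longrightarrow> eigval j C \<le> eigval i C"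
    using symmetric_eigval_decomposition by metis
  have qC: "z \<bullet> (C *v z) = (norm (transpose X *v (Y *v z)))\<^sup>2" for z
  proof -
    have "z \<bullet> (C *v z) = (transpose B *v (B *v z)) \<bullet> z"
      by (simp only: C_def matrix_vector_mul_assoc inner_commute)
    also have "\<dots> = (norm (B *v z))\<^sup>2"
      by (simp only: inner_transpose_mult power2_norm_eq_inner)
    finally show ?thesis by (simp only: B_def matrix_vector_mul_assoc)
  qed
  have nu: "norm (u j) = 1" if "j \<in> {1..CARD('k)}" for j
    using u[of j j] that by (simp add: norm_eq_1)
  have ev: "eigval j C = (norm (transpose X *v (Y *v u j)))\<^sup>2" if "j \<in> {1..CARD('k)}" for j
    unfolding qC[symmetric] by (simp add: eig[OF that] u[OF that that])
  have ev01: "0 \<le> eigval j C \<and> eigval j C \<le> 1" if "j \<in> {1..CARD('k)}" for j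
    using norm_transpose_stiefel_le[OF X, of "Y *v u j"] ev[OF that]
    by (simp add: stiefel_norm[OF Y] nu[OF that] power_le_one del: transpose_matrix_vector)
  \<comment> \<open>The bounds on the eigenvalue place its root in the domain of
    \<open>arccos\<close>, so the sine follows from the Pythagorean identity.\<close>
  have ang: "sin (canonical_angle j X Y) = sqrt (1 - eigval j C)" if "j \<in> {1..CARD('k)}" for j
    using ev01[OF that]
    by (simp add: canonical_angle_def singval_def B_def[symmetric] C_def[symmetric] sin_arccos_abs)
  define m where "m = eigval CARD('k) C"
  have kin: "CARD('k) \<in> {1..CARD('k)}" by (simp add: Suc_le_eq)
  have res: "norm (Y *v z - X *v (transpose X *v (Y *v z))) = sqrt ((norm z)\<^sup>2 - z \<bullet> (C *v z))" for z
    by (rule real_sqrt_unique[symmetric]) (simp_all only: norm_residual[OF X] stiefel_norm[OF Y] qC norm_ge_zero)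
  have "Max ((\<lambda>j. sin (canonical_angle j X Y)) ` {1..CARD('k)}) = sqrt (1 - m)"
  proof (rule Max_eqI)
    fix y assume "y \<in> (\<lambda>j. sin (canonical_angle j X Y)) ` {1..CARD('k)}"
    then obtain j where j: "j \<in> {1..CARD('k)}" "y = sqrt (1 - eigval j C)" using ang by auto
    then show "y \<le> sqrt (1 - m)" using anti[of j "CARD('k)"] by (simp add: m_def)
  next
    show "sqrt (1 - m) \<in> (\<lambda>j. sin (canonical_angle j X Y)) ` {1..CARD('k)}"
      using kin ang[OF kin] by (metis imageI m_def)
  qed simp
  also have "sqrt (1 - m) = subspace_gap X Y"
  \<comment> \<open>One direction tests the gap at the last eigenvector; the other is the Rayleigh
    bound by the smallest eigenvalue \<open>m\<close>.\<close>
  proof (rule antisym)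
    have "sqrt (1 - m) = norm (Y *v u CARD('k) - X *v (transpose X *v (Y *v u CARD('k))))"
      unfolding res using nu[OF kin] by (simp add: m_def eig[OF kin] u[OF kin kin])
    also have "\<dots> \<le> subspace_gap X Y * norm (u CARD('k))" by (rule subspace_gap_bound)
    finally show "sqrt (1 - m) \<le> subspace_gap X Y" by (simp add: nu[OF kin])
  next
    show "subspace_gap X Y \<le> sqrt (1 - m)"
    proof (rule subspace_gap_le)
      fix z :: "real^'k"
      have "m * (z \<bullet> z) = (\<Sum>j=1..CARD('k). m * (u j \<bullet> z)\<^sup>2)"
        by (simp only: orthonormal_parseval[OF u] sum_distrib_left)
      also have "\<dots> \<le> (\<Sum>j=1..CARD('k). eigval j C * (u j \<bullet> z)\<^sup>2)"
        using anti[of _ "CARD('k)"] by (intro sum_mono mult_right_mono) (auto simp: m_def)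
      also have "\<dots> = z \<bullet> (C *v z)" by (rule orthonormal_quadratic_form[OF u eig, symmetric])
      finally have "sqrt ((norm z)\<^sup>2 - z \<bullet> (C *v z)) \<le> sqrt ((1 - m) * (norm z)\<^sup>2)"
        by (simp add: power2_norm_eq_inner left_diff_distrib)
      then show "norm (Y *v z - X *v (transpose X *v (Y *v z))) \<le> sqrt (1 - m) * norm z"
        unfolding res by (simp add: real_sqrt_mult)
    qed
  qed
  finally show ?thesis .
qed

section \<open>The metric \<open>dist2\<close> expressed through basis matrices\<close>

lemma colspace_in_grassmannian: "colspace X \<in> grassmannian TYPE('k)" if "X \<in> stiefel"
  for X :: "real^'k^'n"
  by (simp add: grassmannian_def subspace_colspace dim_colspace[OF that])

lemma grassmannianE:
  fixes S :: "(real^'n) set"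
  assumes "S \<in> grassmannian TYPE('k::finite)"
  obtains X :: "real^'k^'n" where "X \<in> stiefel" "colspace X = S"
  using assms subspace_eq_colspace[of S] unfolding grassmannian_def by blast

lemma dist2_colspace:
  fixes X Y :: "real^'k^'n"
  assumes X: "X \<in> stiefel" and Y: "Y \<in> stiefel"
  shows "dist2 TYPE('k) (colspace X) (colspace Y) = subspace_gap X Y"
proof -
  have "dist2 TYPE('k) (colspace X) (colspace Y) =
      (THE d. \<exists>X' Y' :: real^'k^'n. X' \<in> stiefel \<and> Y' \<in> stiefel \<and> colspace X' = colspace X
        \<and> colspace Y' = colspace Y \<and> d = Max ((\<lambda>j. sin (canonical_angle j X' Y')) ` {1..CARD('k)}))"
    using X Y by (simp add: dist2_def colspace_in_grassmannian)
  also have "\<dots> = subspace_gap X Y"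
  proof (rule the_equality)
    show "\<exists>X' Y' :: real^'k^'n. X' \<in> stiefel \<and> Y' \<in> stiefel \<and> colspace X' = colspace X
        \<and> colspace Y' = colspace Y \<and> subspace_gap X Y = Max ((\<lambda>j. sin (canonical_angle j X' Y')) ` {1..CARD('k)})"
      using X Y Max_sin_canonical_angle[OF X Y] by metis
  next
    fix d assume "\<exists>X' Y' :: real^'k^'n. X' \<in> stiefel \<and> Y' \<in> stiefel \<and> colspace X' = colspace X
        \<and> colspace Y' = colspace Y \<and> d = Max ((\<lambda>j. sin (canonical_angle j X' Y')) ` {1..CARD('k)})"
    then obtain X' Y' :: "real^'k^'n" where *: "X' \<in> stiefel" "Y' \<in> stiefel" "colspace X' = colspace X"
        "colspace Y' = colspace Y" "d = Max ((\<lambda>j. sin (canonical_angle j X' Y')) ` {1..CARD('k)})"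
      by blast
    then show "d = subspace_gap X Y"
      using Max_sin_canonical_angle[OF *(1,2)] subspace_gap_cong[OF X Y *(1-4)] by simp
  qed
  finally show ?thesis .
qed

lemma Metric_space_grassmannian:
  "Metric_space (grassmannian TYPE('k::finite)) (dist2 TYPE('k) :: (real^'n) set \<Rightarrow> _)"
proof
  fix S T :: "(real^'n) set"
  let ?G = "grassmannian TYPE('k) :: (real^'n) set set"
  have *: "0 \<le> dist2 TYPE('k) S T \<and> dist2 TYPE('k) S T = dist2 TYPE('k) T S" if "S \<in> ?G" "T \<in> ?G"
    using that by (elim grassmannianE) (auto simp: dist2_colspace subspace_gap_nonneg subspace_gap_commute)
  \<comment> \<open>The axiom ranges over the whole type; off the Grassmannian the default value 0
    settles it.\<close>
  show "0 \<le> dist2 TYPE('k) S T" using * by (cases "S \<in> ?G \<and> T \<in> ?G") (auto simp: dist2_def)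
  show "dist2 TYPE('k) S T = dist2 TYPE('k) T S" using * by (cases "S \<in> ?G \<and> T \<in> ?G") (auto simp: dist2_def)
  assume ST: "S \<in> ?G" "T \<in> ?G"
  then obtain X Y :: "real^'k^'n" where XY: "X \<in> stiefel" "colspace X = S" "Y \<in> stiefel" "colspace Y = T"
    by (elim grassmannianE)
  show "dist2 TYPE('k) S T = 0 \<longleftrightarrow> S = T"
    using dist2_colspace[OF XY(1,3)] subspace_gap_eq_0_iff[OF XY(1,3)] by (simp add: XY)
  fix U assume "U \<in> ?G"
  then obtain Z :: "real^'k^'n" where Z: "Z \<in> stiefel" "colspace Z = U" by (elim grassmannianE)
  show "dist2 TYPE('k) S U \<le> dist2 TYPE('k) S T + dist2 TYPE('k) T U"
    using subspace_gap_triangle[OF XY(1,3) Z(1)] dist2_colspace[OF XY(1,3)] dist2_colspace[OF XY(1) Z(1)]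
      dist2_colspace[OF XY(3) Z(1)] by (simp add: XY Z)
qed

lemma limitin_colspace:
  fixes X :: "real^'k^'n"
  assumes X: "X \<in> stiefel" and Y: "\<And>i. Y i \<in> stiefel" and lim: "(Y \<longlongrightarrow> X) F"
  shows "limitin (grassmann_topology TYPE('k)) (\<lambda>i. colspace (Y i)) (colspace X) F"
  unfolding grassmann_topology_def Metric_space.limitin_metric_dist_null[OF Metric_space_grassmannian]
  using tendsto_subspace_gap[OF X lim]
  by (simp add: colspace_in_grassmannian X Y dist2_colspace subspace_gap_commute[OF X Y])

lemma regular_space_grassmann: "regular_space (grassmann_topology TYPE('k::finite) :: (real^'n) set topology)"
  unfolding grassmann_topology_def by (rule Metric_space.regular_space_mtopology[OF Metric_space_grassmannian])

lemma Hausdorff_space_grassmann: "Hausdorff_space (grassmann_topology TYPE('k::finite) :: (real^'n) set topology)"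
  unfolding grassmann_topology_def by (rule Metric_space.Hausdorff_space_mtopology[OF Metric_space_grassmannian])


section \<open>Convergence of the SCF iteration\<close>

text \<open>
  If the sequence did not converge, it would leave a closed neighbourhood of \<open>l\<close> infinitely often. The
  points just before these exits accumulate in that neighbourhood, hence at \<open>l\<close>, and so do their
  successors, which contradicts the exit.
\<close>

lemma limitin_isolated_accumulation_point:
  fixes x :: "nat \<Rightarrow> 'a"
  assumes reg: "regular_space T"
    and iso: "isolated_accumulation_point T x l"
    and cpt: "\<And>r. strict_mono r \<Longrightarrow> \<exists>s l'. strict_mono (s :: nat \<Rightarrow> nat) \<and> limitin T (x \<circ> r \<circ> s) l' sequentially"
    and step: "\<And>r. strict_mono r \<Longrightarrow> limitin T (x \<circ> r) l sequentially \<Longrightarrow>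
      \<exists>s. strict_mono s \<and> limitin T (\<lambda>j. x (Suc (r (s j)))) l sequentially"
  shows "limitin T x l sequentially"
proof -
  obtain r0 where r0: "strict_mono r0" "limitin T (x \<circ> r0) l sequentially"
    using iso by (auto simp: isolated_accumulation_point_def accumulation_point_def)
  obtain U where U: "openin T U" "l \<in> U" "\<And>l'. l' \<in> U \<Longrightarrow> accumulation_point T x l' \<Longrightarrow> l' = l"
    using iso by (auto simp: isolated_accumulation_point_def)
  have "\<forall>\<^sub>F n in sequentially. x n \<in> V" if V: "openin T V" "l \<in> V" for V
  proof -
    have "openin T (U \<inter> V)" "l \<in> U \<inter> V" using U(1,2) V by auto
    moreover have "neighbourhood_base_of (closedin T) T"
      using reg by (simp only: neighbourhood_base_of_closedin)
    \<comment> \<open>Exits are recorded from the open set \<open>W\<close>, while limits of exit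
      points are caught in the closed set \<open>C\<close>, which is small enough for isolation
      within \<open>U\<close> to identify them.\<close>
    ultimately obtain W C where W: "openin T W" "closedin T C" "l \<in> W" "W \<subseteq> C" "C \<subseteq> U \<inter> V"
      unfolding neighbourhood_base_of by meson
    have into: "\<exists>n\<ge>m. x n \<in> W" for m
    proof -
      obtain N where N: "\<And>j. j \<ge> N \<Longrightarrow> x (r0 j) \<in> W"
        using r0(2) W(1,3) by (auto simp: limitin_sequentially)
      have "m \<le> r0 (max N m)"
        using seq_suble[OF r0(1), of "max N m"] by simp
      then show ?thesis using N[of "max N m"] by auto
    qed
    have "\<forall>\<^sub>F n in sequentially. x n \<in> W"
    proof (rule ccontr)
      assume "\<not> ?thesis"
      then have out: "\<exists>n\<ge>m. x n \<notin> W" for m by (auto simp: eventually_sequentially)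
      define E where "E = {n. x n \<in> W \<and> x (Suc n) \<notin> W}"
      \<comment> \<open>The sequence visits \<open>W\<close> arbitrarily late. Without a later exit
        it would remain in \<open>W\<close> from such a visit on, contrary to
        \<open>out\<close>.\<close>
      have "\<exists>n\<ge>m. n \<in> E" for m
      proof (rule ccontr)
        assume no: "\<not> ?thesis"
        obtain a where a: "a \<ge> m" "x a \<in> W" using into by blast
        have "x n \<in> W" if "n \<ge> a" for n
          using that by (induction n rule: dec_induct) (use a no in \<open>auto simp: E_def\<close>)
        then show False using out[of a] by blast
      qed
      then have inf: "infinite E" by (simp add: infinite_nat_iff_unbounded_le)
      define r where "r = enumerate E"
      have r: "strict_mono r" "\<And>j. r j \<in> E"
        using inf by (auto simp: r_def strict_mono_enumerate enumerate_in_set)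
      obtain s l' where s: "strict_mono s" "limitin T (x \<circ> r \<circ> s) l' sequentially"
        using cpt[OF r(1)] by blast
      have rs: "strict_mono (r \<circ> s)" using r(1) s(1) by (simp add: strict_mono_o)
      have "l' \<in> C"
        using r(2) W(4) by (intro limitin_closedin[OF s(2) W(2)]) (auto simp: E_def subset_iff)
      moreover have "accumulation_point T x l'"
        unfolding accumulation_point_def using rs s(2) by (metis comp_assoc)
      ultimately have "l' = l" using U(3) W(5) by blast
      then obtain t where t: "strict_mono t" "limitin T (\<lambda>j. x (Suc ((r \<circ> s) (t j)))) l sequentially"
        using step[OF rs] s(2) by (metis comp_assoc)
      then obtain N where "x (Suc ((r \<circ> s) (t N))) \<in> W"
        using W(1,3) by (auto simp: limitin_sequentially)
      then show False using r(2)[of "s (t N)"] by (simp add: E_def)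
    qed
    then show ?thesis using W by (auto elim!: eventually_mono)
  qed
  then show ?thesis using limitin_topspace[OF r0(2)] by (auto simp: limitin_def)
qed

section \<open>Limits of Stiefel sequences and the abstract iteration\<close>

lemma stiefel_subsequence:
  fixes X :: "nat \<Rightarrow> real^'k^'n"
  assumes "\<And>i. X i \<in> stiefel"
  obtains s l where "strict_mono s" "l \<in> stiefel" "(\<lambda>j. X (s j)) \<longlonglongrightarrow> l"
  using compact_stiefel assms unfolding compact_def comp_def by metis

lemma stiefel_limit:
  fixes X :: "nat \<Rightarrow> real^'k^'n"
  assumes "\<And>i. X i \<in> stiefel" "X \<longlonglongrightarrow> l"
  shows "l \<in> stiefel"
  using closed_sequentially[OF compact_imp_closed[OF compact_stiefel]] assms by blast

lemma LIMSEQ_strict_mono: "X \<longlonglongrightarrow> l \<Longrightarrow> strict_mono r \<Longrightarrow> (\<lambda>j. X (r j)) \<longlonglongrightarrow> l"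
  using LIMSEQ_subseq_LIMSEQ[of X l r] by (simp add: comp_def)

text \<open>Such an \<open>A\<close> is an involution, so \<open>A *v x - x\<close> is negated by
  \<open>A\<close>; positive semidefiniteness then forces it to vanish.\<close>

lemma symmetric_psd_stiefel_eq_id:
  fixes A :: "real^'k^'k"
  assumes A: "A \<in> stiefel" and sym: "transpose A = A" and psd: "\<And>x. 0 \<le> x \<bullet> (A *v x)"
  shows "A = mat 1"
proof -
  have "A *v x = x" for x
  proof -
    have AA: "A *v (A *v x) = x"
      using stiefel_vec_cancel[OF A, of x] by (simp only: sym)
    define y where "y = A *v x - x"
    have "A *v y = - y" by (simp add: y_def matrix_vector_mult_diff_distrib AA)
    then have "y \<bullet> y = 0" using psd[of y] inner_ge_zero[of y] by simp
    then have "y = 0" by simp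
    then show ?thesis by (simp add: y_def)
  qed
  then show ?thesis by (simp add: matrix_eq)
qed

text \<open>The objective and the Ansatz enter only through two consequences: each successor
  maximises the current trace form, and the gains vanish.\<close>

locale scf_sequence =
  fixes H :: "real^'k^'n \<Rightarrow> real^'n^'n" and P :: "nat \<Rightarrow> real^'k^'n"
  assumes card_less: "CARD('k) < CARD('n)"
    and cont_H: "continuous_on stiefel H"
    and sym_H: "X \<in> stiefel \<Longrightarrow> transpose (H X) = H X"
    and P_stiefel: "P i \<in> stiefel"
    and P_max: "(Y :: real^'k^'n) \<in> stiefel \<Longrightarrow> trace_form (H (P i)) Y \<le> trace_form (H (P i)) (P (Suc i))"
    and P_gain: "(\<lambda>i. trace_form (H (P i)) (P (Suc i)) - trace_form (H (P i)) (P i)) \<longlonglongrightarrow> 0"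
begin

text \<open>The convergent sequence \<open>Z\<close> is kept apart from \<open>P\<close> so that (d)
  can insert the aligned iterates; the hypotheses on \<open>H\<close> and on the trace form say that
  \<open>Z j\<close> may stand in for \<open>P (r j)\<close>. For (b) and (c), \<open>Z\<close> is
  the subsequence itself.\<close>

lemma successor_limit:
  assumes r: "strict_mono r" and Z: "\<And>j. Z j \<in> stiefel" "Z \<longlonglongrightarrow> Z'"
    and HZ: "\<And>j. H (Z j) = H (P (r j))"
    and tZ: "\<And>j. trace_form (H (P (r j))) (Z j) = trace_form (H (P (r j))) (P (r j))"
    and gap: "eigval CARD('k) (H Z') - eigval (CARD('k) + 1) (H Z') > 0"
  obtains s W where "strict_mono s" "W \<in> stiefel" "(\<lambda>j. P (Suc (r (s j)))) \<longlonglongrightarrow> W"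
    "colspace W = colspace Z'"
proof -
  obtain s W where s: "strict_mono s" "W \<in> stiefel" "(\<lambda>j. P (Suc (r (s j)))) \<longlonglongrightarrow> W"
    using stiefel_subsequence[of "\<lambda>j. P (Suc (r j))"] P_stiefel by blast
  have Z': "Z' \<in> stiefel" by (rule stiefel_limit[OF Z])
  have Zs: "(\<lambda>j. Z (s j)) \<longlonglongrightarrow> Z'" by (rule LIMSEQ_strict_mono[OF Z(2) s(1)])
  have HZs: "(\<lambda>j. H (Z (s j))) \<longlonglongrightarrow> H Z'"
    by (rule continuous_on_tendsto_compose[OF cont_H Zs Z']) (simp add: Z)
  have tW: "(\<lambda>j. trace_form (H (Z (s j))) (P (Suc (r (s j))))) \<longlonglongrightarrow> trace_form (H Z') W"
    by (rule tendsto_trace_form[OF HZs s(3)])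
  have W_max: "trace_form (H Z') Y \<le> trace_form (H Z') W" if "Y \<in> stiefel" for Y :: "real^'k^'n"
    by (rule LIMSEQ_le[OF tendsto_trace_form[OF HZs tendsto_const] tW]) (simp add: HZ P_max[OF that])
  have "(\<lambda>j. trace_form (H (Z (s j))) (P (Suc (r (s j)))) - trace_form (H (Z (s j))) (Z (s j)))
      \<longlonglongrightarrow> trace_form (H Z') W - trace_form (H Z') Z'"
    by (intro tendsto_diff tW tendsto_trace_form HZs Zs)
  moreover have "(\<lambda>j. trace_form (H (Z (s j))) (P (Suc (r (s j)))) - trace_form (H (Z (s j))) (Z (s j))) \<longlonglongrightarrow> 0"
    using LIMSEQ_strict_mono[OF P_gain strict_mono_o[OF r s(1)]] by (simp add: HZ tZ)
  \<comment> \<open>The vanishing gain makes \<open>Z'\<close> a maximiser alongside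
    \<open>W\<close>, so the gap at \<open>Z'\<close> identifies their column spaces.\<close>
  ultimately have "trace_form (H Z') W - trace_form (H Z') Z' = 0" by (rule LIMSEQ_unique)
  then have "colspace Z' = colspace W"
    by (intro ky_fan_unique[OF sym_H[OF Z'] card_less gap s(2) W_max Z']) simp_all
  with s that show thesis by metis
qed

lemma colspace_accumulation_point:
  assumes "accumulation_point euclidean P P'"
  shows "accumulation_point (grassmann_topology TYPE('k)) (\<lambda>i. colspace (P i)) (colspace P')"
proof -
  obtain r where r: "strict_mono r" "(\<lambda>j. P (r j)) \<longlonglongrightarrow> P'"
    using assms by (auto simp: accumulation_point_def comp_def)
  have "limitin (grassmann_topology TYPE('k)) (\<lambda>j. colspace (P (r j))) (colspace P') sequentially"
    by (intro limitin_colspace r stiefel_limit[OF _ r(2)] P_stiefel)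
  then show ?thesis using r by (auto simp: accumulation_point_def comp_def)
qed

lemma colspace_convergence:
  assumes P': "P' \<in> stiefel"
    and iso: "isolated_accumulation_point (grassmann_topology TYPE('k)) (\<lambda>i. colspace (P i)) (colspace P')"
    and gap: "\<And>Q :: real^'k^'k. Q \<in> stiefel \<Longrightarrow>
      eigval CARD('k) (H (P' ** Q)) - eigval (CARD('k) + 1) (H (P' ** Q)) > 0"
  shows "limitin (grassmann_topology TYPE('k)) (\<lambda>i. colspace (P i)) (colspace P') sequentially"
proof (rule limitin_isolated_accumulation_point[OF regular_space_grassmann iso])
  fix r :: "nat \<Rightarrow> nat" assume r: "strict_mono r"
  \<comment> \<open>This matrix subsequence serves both obligations: its limit supplies the
    compactness in the Grassmannian and starts the successor argument.\<close>
  obtain s l where s: "strict_mono s" "l \<in> stiefel" "(\<lambda>j. P (r (s j))) \<longlonglongrightarrow> l"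
    using stiefel_subsequence[of "\<lambda>j. P (r j)"] P_stiefel by blast
  have lim: "limitin (grassmann_topology TYPE('k)) (\<lambda>j. colspace (P (r (s j)))) (colspace l) sequentially"
    by (intro limitin_colspace s P_stiefel)
  then show "\<exists>s l'. strict_mono s \<and>
      limitin (grassmann_topology TYPE('k)) ((\<lambda>i. colspace (P i)) \<circ> r \<circ> s) l' sequentially"
    using s(1) by (auto simp: comp_def)
  assume rl: "limitin (grassmann_topology TYPE('k)) ((\<lambda>i. colspace (P i)) \<circ> r) (colspace P') sequentially"
  have "limitin (grassmann_topology TYPE('k)) (\<lambda>j. colspace (P (r (s j)))) (colspace P') sequentially"
    using limitin_subsequence[OF s(1) rl] by (simp add: comp_def)
  then have "colspace l = colspace P'"
    using limitin_Hausdorff_unique[OF lim _ _ Hausdorff_space_grassmann] by simp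
  \<comment> \<open>The limit \<open>l\<close> is known only up to this factor, and the gap
    hypothesis is invoked at \<open>P' ** Q\<close>.\<close>
  then obtain Q :: "real^'k^'k" where Q: "Q \<in> stiefel" "l = P' ** Q"
    using colspace_eq_imp_mult[OF P' s(2)] by blast
  obtain t W where t: "strict_mono t" "W \<in> stiefel" "(\<lambda>j. P (Suc ((r \<circ> s) (t j)))) \<longlonglongrightarrow> W"
      "colspace W = colspace l"
    by (rule successor_limit[OF strict_mono_o[OF r s(1)], of "\<lambda>j. P (r (s j))" l])
       (use P_stiefel s(3) gap Q in auto)
  have "limitin (grassmann_topology TYPE('k)) (\<lambda>j. colspace (P (Suc ((r \<circ> s) (t j))))) (colspace W) sequentially"
    by (intro limitin_colspace t P_stiefel)
  then show "\<exists>s. strict_mono s \<and>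
      limitin (grassmann_topology TYPE('k)) (\<lambda>j. colspace (P (Suc (r (s j))))) (colspace P') sequentially"
    using t(4) \<open>colspace l = colspace P'\<close> strict_mono_o[OF s(1) t(1)] by (intro exI[of _ "s \<circ> t"]) simp
qed

text \<open>Since \<open>f (P i)\<close> converges, continuity gives \<open>f\<close> the same value
  at \<open>P'\<close> and at the successor limit \<open>W\<close>. Both lie in one orbit, where
  \<open>P'\<close> is the strict maximiser, so \<open>W = P'\<close>.\<close>

lemma convergence_unique_maximizer:
  fixes f :: "real^'k^'n \<Rightarrow> real"
  assumes iso: "isolated_accumulation_point euclidean P P'"
    and f: "continuous_on stiefel f" "convergent (\<lambda>i. f (P i))"
    and gap: "eigval CARD('k) (H P') - eigval (CARD('k) + 1) (H P') > 0"
    and max: "\<And>X. X \<in> stiefel \<Longrightarrow> X \<noteq> P' \<Longrightarrow> colspace X = colspace P' \<Longrightarrow> f P' > f X"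
  shows "P \<longlonglongrightarrow> P'"
proof -
  have "limitin euclidean P P' sequentially"
  proof (rule limitin_isolated_accumulation_point[OF regular_space_euclidean iso])
    fix r :: "nat \<Rightarrow> nat" assume r: "strict_mono r"
    show "\<exists>s l'. strict_mono s \<and> limitin euclidean (P \<circ> r \<circ> s) l' sequentially"
    proof -
      obtain s l where "strict_mono s" "(\<lambda>j. P (r (s j))) \<longlonglongrightarrow> l"
        using stiefel_subsequence[of "\<lambda>j. P (r j)"] P_stiefel by blast
      then show ?thesis by (auto simp: comp_def)
    qed
    assume "limitin euclidean (P \<circ> r) P' sequentially"
    then have rl: "(\<lambda>j. P (r j)) \<longlonglongrightarrow> P'" by (simp add: comp_def)
    have P': "P' \<in> stiefel" by (rule stiefel_limit[OF _ rl]) (rule P_stiefel)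
    obtain s W where s: "strict_mono s" "W \<in> stiefel" "(\<lambda>j. P (Suc (r (s j)))) \<longlonglongrightarrow> W"
        "colspace W = colspace P'"
      by (rule successor_limit[OF r, of "\<lambda>j. P (r j)" P']) (use P_stiefel rl gap in auto)
    obtain L where L: "(\<lambda>i. f (P i)) \<longlonglongrightarrow> L" using f(2) by (auto simp: convergent_def)
    have "(\<lambda>j. f (P (r j))) \<longlonglongrightarrow> f P'"
      by (rule continuous_on_tendsto_compose[OF f(1) rl P']) (simp add: P_stiefel)
    then have "f P' = L" using LIMSEQ_strict_mono[OF L r] LIMSEQ_unique by blast
    have "(\<lambda>j. f (P (Suc (r (s j))))) \<longlonglongrightarrow> f W"
      by (rule continuous_on_tendsto_compose[OF f(1) s(3,2)]) (simp add: P_stiefel)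
    moreover have "(\<lambda>j. f (P (Suc (r (s j))))) \<longlonglongrightarrow> L"
      using LIMSEQ_strict_mono[OF LIMSEQ_Suc[OF L] strict_mono_o[OF r s(1)]] by simp
    ultimately have "f W = f P'" using LIMSEQ_unique \<open>f P' = L\<close> by blast
    then have "W = P'" using max[OF s(2) _ s(4)] by fastforce
    then show "\<exists>s. strict_mono s \<and> limitin euclidean (\<lambda>j. P (Suc (r (s j)))) P' sequentially"
      using s by auto
  qed
  then show ?thesis by simp
qed

text \<open>Alignment is a condition that survives limits: if the successors tend to
  \<open>P' ** Q\<close> and their polar factors to \<open>V'\<close>, then
  \<open>transpose (Q ** V')\<close> is symmetric positive semidefinite as well as orthogonal. It is
  thus the identity, and the aligned successors tend to \<open>P'\<close>.\<close>

lemma aligned_convergence: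
  fixes V :: "nat \<Rightarrow> real^'k^'k"
  assumes inv: "right_unitarily_invariant_on stiefel H"
    and V: "\<And>i. orthonormal_polar_factor (transpose (P i) ** P') (V i)"
    and iso: "isolated_accumulation_point euclidean (\<lambda>i. P i ** V i) P'"
    and gap: "eigval CARD('k) (H P') - eigval (CARD('k) + 1) (H P') > 0"
  shows "(\<lambda>i. P i ** V i) \<longlonglongrightarrow> P'"
proof -
  have V_st: "V i \<in> stiefel" for i using V by (auto simp: orthonormal_polar_factor_def)
  have X_st: "P i ** V i \<in> stiefel" for i by (intro stiefel_mult P_stiefel V_st)
  have HX: "H (P i ** V i) = H (P i)" for i
    using inv P_stiefel V_st X_st unfolding right_unitarily_invariant_on_def by blast
  \<comment> \<open>Multiplying by \<open>transpose (V i)\<close> recovers the semidefinite factor,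
    so the polar property becomes closed conditions on an explicit expression.\<close>
  have polar: "transpose (transpose (V i) ** (transpose (P i) ** P')) = transpose (V i) ** (transpose (P i) ** P')"
      "0 \<le> x \<bullet> ((transpose (V i) ** (transpose (P i) ** P')) *v x)" for i x
  proof -
    obtain \<Omega> where \<Omega>: "transpose \<Omega> = \<Omega>" "\<And>x. 0 \<le> x \<bullet> (\<Omega> *v x)" "transpose (P i) ** P' = V i ** \<Omega>"
      using V[of i] by (auto simp: orthonormal_polar_factor_def)
    have "transpose (V i) ** (transpose (P i) ** P') = \<Omega>"
      by (simp add: \<Omega>(3) matrix_mul_assoc stiefel_eq[OF V_st])
    then show "transpose (transpose (V i) ** (transpose (P i) ** P')) = transpose (V i) ** (transpose (P i) ** P')"
      "0 \<le> x \<bullet> ((transpose (V i) ** (transpose (P i) ** P')) *v x)" using \<Omega> by auto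
  qed
  have "limitin euclidean (\<lambda>i. P i ** V i) P' sequentially"
  proof (rule limitin_isolated_accumulation_point[OF regular_space_euclidean iso])
    fix r :: "nat \<Rightarrow> nat" assume r: "strict_mono r"
    show "\<exists>s l'. strict_mono s \<and> limitin euclidean ((\<lambda>i. P i ** V i) \<circ> r \<circ> s) l' sequentially"
    proof -
      obtain s l where "strict_mono s" "(\<lambda>j. P (r (s j)) ** V (r (s j))) \<longlonglongrightarrow> l"
        using stiefel_subsequence[of "\<lambda>j. P (r j) ** V (r j)"] X_st by blast
      then show ?thesis by (auto simp: comp_def)
    qed
    assume "limitin euclidean ((\<lambda>i. P i ** V i) \<circ> r) P' sequentially"
    then have rl: "(\<lambda>j. P (r j) ** V (r j)) \<longlonglongrightarrow> P'" by (simp add: comp_def)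
    have P': "P' \<in> stiefel" by (rule stiefel_limit[OF _ rl]) (rule X_st)
    obtain s W where s: "strict_mono s" "W \<in> stiefel" "(\<lambda>j. P (Suc (r (s j)))) \<longlonglongrightarrow> W"
        "colspace W = colspace P'"
      by (rule successor_limit[OF r, of "\<lambda>j. P (r j) ** V (r j)" P'])
         (use X_st rl gap in \<open>auto simp: HX trace_form_mult[OF V_st]\<close>)
    obtain Q :: "real^'k^'k" where Q: "Q \<in> stiefel" "W = P' ** Q"
      using colspace_eq_imp_mult[OF P' s(2,4)] by blast
    \<comment> \<open>The polar factors need not converge along \<open>s\<close>; compactness of the
      orthogonal group supplies a further subsequence.\<close>
    obtain t V' where t: "strict_mono t" "V' \<in> stiefel" "(\<lambda>j. V (Suc (r (s (t j))))) \<longlonglongrightarrow> V'"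
      using stiefel_subsequence[of "\<lambda>j. V (Suc (r (s j)))"] V_st by blast
    have Pt: "(\<lambda>j. P (Suc (r (s (t j))))) \<longlonglongrightarrow> W" by (rule LIMSEQ_strict_mono[OF s(3) t(1)])
    define \<Omega> where "\<Omega> j = transpose (V (Suc (r (s (t j))))) ** (transpose (P (Suc (r (s (t j))))) ** P')" for j
    define \<Omega>' where "\<Omega>' = transpose V' ** (transpose W ** P')"
    have lim: "\<Omega> \<longlonglongrightarrow> \<Omega>'"
      unfolding \<Omega>_def \<Omega>'_def by (intro tendsto_matrix_mult tendsto_transpose tendsto_const Pt t(3))
    have "transpose W ** P' = transpose Q"
      by (simp add: Q(2) matrix_transpose_mul stiefel_eq[OF P'] flip: matrix_mul_assoc)
    then have \<Omega>': "\<Omega>' = transpose (Q ** V')" by (simp add: \<Omega>'_def matrix_transpose_mul)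
    have "\<Omega>' = mat 1"
    proof (rule symmetric_psd_stiefel_eq_id)
      show "\<Omega>' \<in> stiefel" unfolding \<Omega>' by (intro transpose_stiefel stiefel_mult Q t)
      have "transpose (\<Omega> j) = \<Omega> j" for j unfolding \<Omega>_def by (rule polar(1))
      then have "\<Omega> \<longlonglongrightarrow> transpose \<Omega>'"
        using tendsto_transpose[OF lim] by simp
      then show "transpose \<Omega>' = \<Omega>'" using lim LIMSEQ_unique by blast
      fix x :: "real^'k"
      have "(\<lambda>j. x \<bullet> (\<Omega> j *v x)) \<longlonglongrightarrow> x \<bullet> (\<Omega>' *v x)"
        unfolding matrix_vector_mult_def
        by (intro tendsto_inner tendsto_const tendsto_vec_lambda tendsto_sum tendsto_mult tendsto_vec_nth lim)
      then show "0 \<le> x \<bullet> (\<Omega>' *v x)"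
        by (rule LIMSEQ_le_const) (auto simp: \<Omega>_def polar(2))
    qed
    then have "Q ** V' = mat 1" unfolding \<Omega>' by (metis transpose_mat transpose_transpose)
    then have "W ** V' = P'" by (simp add: Q(2) flip: matrix_mul_assoc)
    then have "(\<lambda>j. P (Suc (r (s (t j)))) ** V (Suc (r (s (t j))))) \<longlonglongrightarrow> P'"
      using tendsto_matrix_mult[OF Pt t(3)] by simp
    then show "\<exists>s. strict_mono s \<and>
        limitin euclidean (\<lambda>j. P (Suc (r (s j))) ** V (Suc (r (s j)))) P' sequentially"
      using strict_mono_o[OF s(1) t(1)] by (intro exI[of _ "s \<circ> t"]) simp
  qed
  then show ?thesis by simp
qed

end

section \<open>From the algorithm to the abstract iteration\<close>

lemma stiefel_subset_nbhd: "stiefel \<subseteq> stiefel_nbhd N \<delta>" if "matrix_norm N" "\<delta> > 0"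
proof -
  have "N 0 = 0" using that(1) unfolding matrix_norm_def by blast
  then show ?thesis using that(2) by (auto simp: stiefel_def stiefel_nbhd_def)
qed

lemma NEPv_SCF_step:
  fixes P :: "nat \<Rightarrow> real^'k^'n" and Y :: "real^'k^'n"
  assumes k: "CARD('k) < CARD('n)" and sym: "\<forall>X\<in>stiefel. transpose (H X) = H X"
    and PP: "PP \<subseteq> stiefel" and scf: "NEPv_SCF f H PP \<omega> P"
  shows "P i \<in> stiefel"
    and "Y \<in> stiefel \<Longrightarrow> trace_form (H (P i)) Y \<le> trace_form (H (P i)) (P (Suc i))"
    and "f (P (Suc i)) \<ge> f (P i) + \<omega> * (trace_form (H (P i)) (P (Suc i)) - trace_form (H (P i)) (P i))"
proof -
  show Pi: "P i \<in> stiefel" using scf PP unfolding NEPv_SCF_def by (cases i) auto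
  obtain Phat and Q :: "real^'k^'k" where *: "top_eigenspace_basis (H (P i)) Phat" "Q \<in> stiefel"
      "P (Suc i) = Phat ** Q"
      "f (P (Suc i)) \<ge> f (P i) + \<omega> * (trace_form (H (P i)) Phat - trace_form (H (P i)) (P i))"
    using scf unfolding NEPv_SCF_def by blast
  have tr: "trace_form (H (P i)) (P (Suc i)) = trace_form (H (P i)) Phat"
    by (simp add: *(3) trace_form_mult[OF *(2)])
  then show "f (P (Suc i)) \<ge> f (P i) + \<omega> * (trace_form (H (P i)) (P (Suc i)) - trace_form (H (P i)) (P i))"
    using *(4) by simp
  have symi: "transpose (H (P i)) = H (P i)" using sym Pi by blast
  show "trace_form (H (P i)) Y \<le> trace_form (H (P i)) (P (Suc i))" if "Y \<in> stiefel"
    unfolding tr trace_form_top_eigenspace_basis[OF symi *(1)] by (rule ky_fan[OF symi k that])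
qed

text \<open>Monotone and bounded values of \<open>f\<close> converge, so their increments vanish;
  divided by \<open>\<omega>\<close> these increments dominate the nonnegative gains in the trace
  form.\<close>

lemma NEPv_SCF_convergent:
  fixes P :: "nat \<Rightarrow> real^'k^'n"
  assumes k: "CARD('k) < CARD('n)" and sym: "\<forall>X\<in>stiefel. transpose (H X) = H X"
    and PP: "PP \<subseteq> stiefel" and scf: "NEPv_SCF f H PP \<omega> P"
    and f: "continuous_on stiefel f" and \<omega>: "\<omega> > 0"
  shows "convergent (\<lambda>i. f (P i))"
    and "(\<lambda>i. trace_form (H (P i)) (P (Suc i)) - trace_form (H (P i)) (P i)) \<longlonglongrightarrow> 0"
proof -
  note step = NEPv_SCF_step[OF k sym PP scf]
  define \<eta> where "\<eta> i = trace_form (H (P i)) (P (Suc i)) - trace_form (H (P i)) (P i)" for i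
  have \<eta>: "0 \<le> \<eta> i" "f (P i) + \<omega> * \<eta> i \<le> f (P (Suc i))" for i
    using step(2)[OF step(1), of i i] step(3)[of i] by (auto simp: \<eta>_def)
  have "incseq (\<lambda>i. f (P i))"
  proof (rule incseq_SucI)
    fix i
    have "0 \<le> \<omega> * \<eta> i" using \<eta>(1) \<omega> by simp
    then show "f (P i) \<le> f (P (Suc i))" using \<eta>(2)[of i] by linarith
  qed
  moreover have "bounded (f ` stiefel)"
    by (intro compact_imp_bounded compact_continuous_image f compact_stiefel)
  then obtain B where "\<And>X. X \<in> stiefel \<Longrightarrow> norm (f X) \<le> B" by (auto simp: bounded_iff)
  then have "Bseq (\<lambda>i. f (P i))" using step(1) by (intro BseqI'[of _ B]) blast
  ultimately show conv: "convergent (\<lambda>i. f (P i))"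
    by (intro Bseq_monoseq_convergent incseq_imp_monoseq)
  then obtain L where L: "(\<lambda>i. f (P i)) \<longlonglongrightarrow> L" by (auto simp: convergent_def)
  have "(\<lambda>i. (f (P (Suc i)) - f (P i)) / \<omega>) \<longlonglongrightarrow> (L - L) / \<omega>"
    using \<omega> by (intro tendsto_divide tendsto_diff L LIMSEQ_Suc[OF L] tendsto_const) simp
  then have lim: "(\<lambda>i. (f (P (Suc i)) - f (P i)) / \<omega>) \<longlonglongrightarrow> 0" by simp
  have "\<eta> \<longlonglongrightarrow> 0"
  proof (rule tendsto_sandwich[OF _ _ tendsto_const lim])
    show "\<forall>\<^sub>F i in sequentially. 0 \<le> \<eta> i" using \<eta>(1) by simp
    show "\<forall>\<^sub>F i in sequentially. \<eta> i \<le> (f (P (Suc i)) - f (P i)) / \<omega>"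
      using \<eta>(2) \<omega> by (intro always_eventually allI) (simp add: pos_le_divide_eq algebra_simps)
  qed
  then show "(\<lambda>i. trace_form (H (P i)) (P (Suc i)) - trace_form (H (P i)) (P i)) \<longlonglongrightarrow> 0"
    by (simp add: \<eta>_def[abs_def])
qed

theorem theorem6p5:
  fixes f :: "real^'k^'n \<Rightarrow> real"
    and H :: "real^'k^'n \<Rightarrow> real^'n^'n"
    and PP :: "(real^'k^'n) set"
    and N :: "real^'k^'k \<Rightarrow> real"
    and \<delta> \<omega> :: real
    and P :: "nat \<Rightarrow> real^'k^'n"
    and Ps :: "real^'k^'n"
  assumes "CARD('k) < CARD('n)"
    and "matrix_norm N" and "\<delta> > 0"
    and "f differentiable_on stiefel_nbhd N \<delta>"
    and "continuous_on stiefel H"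
    and "\<forall>X\<in>stiefel. transpose (H X) = H X"
    and "PP \<subseteq> stiefel"
    and "NEPv_ansatz f H PP \<omega>"
    and "NEPv_SCF f H PP \<omega> P"
    and "accumulation_point euclidean P Ps"
  shows
    "accumulation_point (grassmann_topology TYPE('k)) (\<lambda>i. colspace (P i)) (colspace Ps)
     \<and>
     (isolated_accumulation_point (grassmann_topology TYPE('k)) (\<lambda>i. colspace (P i)) (colspace Ps) \<and>
      (\<forall>Q::real^'k^'k. Q \<in> stiefel \<longrightarrow>
         eigval CARD('k) (H (Ps ** Q)) - eigval (CARD('k) + 1) (H (Ps ** Q)) > 0)
      \<longrightarrow> limitin (grassmann_topology TYPE('k)) (\<lambda>i. colspace (P i)) (colspace Ps) sequentially)
     \<and>
     (isolated_accumulation_point euclidean P Ps \<and>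
      eigval CARD('k) (H Ps) - eigval (CARD('k) + 1) (H Ps) > 0 \<and>
      (\<forall>X\<in>stiefel. X \<noteq> Ps \<and> colspace X = colspace Ps \<longrightarrow> f Ps > f X)
      \<longrightarrow> P \<longlonglongrightarrow> Ps)
     \<and>
     (right_unitarily_invariant_on (stiefel_nbhd N \<delta>) f \<and>
      right_unitarily_invariant_on stiefel H
      \<longrightarrow> (\<forall>V :: nat \<Rightarrow> real^'k^'k.
            (\<forall>i. orthonormal_polar_factor (transpose (P i) ** Ps) (V i)) \<and>
            isolated_accumulation_point euclidean (\<lambda>i. P i ** V i) Ps \<and>
            eigval CARD('k) (H Ps) - eigval (CARD('k) + 1) (H Ps) > 0
            \<longrightarrow> (\<lambda>i. P i ** V i) \<longlonglongrightarrow> Ps))"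
proof -
  note k = assms(1) and symH = assms(6) and PP = assms(7) and scf = assms(9)
  have \<omega>: "\<omega> > 0" using assms(8) by (simp add: NEPv_ansatz_def)
  have f: "continuous_on stiefel f"
    using differentiable_imp_continuous_on[OF assms(4)] stiefel_subset_nbhd[OF assms(2,3)]
    by (rule continuous_on_subset)
  note conv = NEPv_SCF_convergent[OF k symH PP scf f \<omega>]
  interpret scf_sequence H P
    by unfold_locales
      (use assms(1,5,6) NEPv_SCF_step(1,2)[OF k symH PP scf] conv(2) in \<open>auto simp del: One_nat_def\<close>)
  have Ps: "Ps \<in> stiefel"
  proof -
    obtain r where "(\<lambda>j. P (r j)) \<longlonglongrightarrow> Ps"
      using assms(10) by (auto simp: accumulation_point_def comp_def)
    then show ?thesis by (rule stiefel_limit[rotated]) (rule P_stiefel)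
  qed
  show ?thesis
    using colspace_accumulation_point[OF assms(10)] colspace_convergence[OF Ps]
      convergence_unique_maximizer[OF _ f conv(1)] aligned_convergence by blast
qed

end
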